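(* Let $\mathcal{C}\subseteq\mathbb{R}^n$ be a closed convex cone, $x_0\in\mathcal{C}$, $x_0\ne0$, $\bar x_0=x_0/\|x_0\|_2$. Let $\|\cdot\|_{(1)},\dots,\|\cdot\|_{(\tau)}$ be norms on $\mathbb{R}^n$ with Lipschitz constants $L_i$ with respect to $\|\cdot\|_2$ and let $\kappa_i=\|\bar x_0\|_{(i)}/L_i$. Let $f(x)=\sum_{i=1}^\tau\lambda_i\|x\|_{(i)}$ for nonnegative weights $\lambda_i$, not all zero, and $\bar\lambda_i=\frac{\lambda_iL_i}{\sum_{j=1}^\tau\lambda_jL_j}$. Let $A\in\mathbb{R}^{m\times n}$ have i.i.d. $\mathcal{N}(0,1)$ entries and let $$m_{low}'=\frac{n(1-\bar D(\mathcal{C}))\left(\sum_{i=1}^\tau\bar\lambda_i\kappa_i\right)^2}{100}.$$ Then whenever $m\le m_{low}'$, with probability at least $1-10\exp\!\left(-\tfrac1{16}\min\{m_{low}',(1-\bar D(\mathcal{C}))^2n\}\right)$, $x_0$ is not a minimizer of the program $$\text{minimize}_{x\in\mathcal{C}}\ f(x)\quad\text{subject to}\quad Ax=Ax_0.$$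
   Context: For a closed convex set $\mathcal{M}\subseteq\mathbb{R}^n$, the Gaussian distance is $D(\mathcal{M})=\mathbb{E}[\inf_{v\in\mathcal{M}}\|\mathbf{h}-v\|_2]$, where $\mathbf{h}\in\mathbb{R}^n$ has independent standard normal entries, and $\bar D(\mathcal{M})=D(\mathcal{M})/\sqrt n$. The Lipschitz constant of a norm is $L=\sup_{z_1\ne z_2}\frac{\|z_1\|-\|z_2\|}{\|z_1-z_2\|_2}$. *)

theory Defs
  imports "HOL-Probability.Probability"
begin

definition is_norm :: "('a::real_vector \<Rightarrow> real) \<Rightarrow> bool" where
  "is_norm N \<longleftrightarrow>
     (\<forall>x. 0 \<le> N x) \<and> (\<forall>x. N x = 0 \<longleftrightarrow> x = 0) \<and>
     (\<forall>c x. N (c *\<^sub>R x) = \<bar>c\<bar> * N x) \<and>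
     (\<forall>x y. N (x + y) \<le> N x + N y)"

(* For a norm N on a Euclidean space the quotients are bounded, so Sup is the genuine supremum. *)
definition lipschitz_const :: "('a::euclidean_space \<Rightarrow> real) \<Rightarrow> real" where
  "lipschitz_const N = Sup {(N z1 - N z2) / norm (z1 - z2) | z1 z2. z1 \<noteq> z2}"

(* The vector h with independent standard normal entries is realized on the product space;
   infdist h S is the infimum of norm (h - v) over v in S when S is nonempty. *)
definition gaussian_dist :: "(real ^ 'n::finite) set \<Rightarrow> real" where
  "gaussian_dist S =
     (\<integral>g. infdist (\<chi> i. g i) S \<partial>(\<Pi>\<^sub>M i\<in>(UNIV :: 'n set). density lborel std_normal_density))"

definition normalized_gaussian_dist :: "(real ^ 'n::finite) set \<Rightarrow> real" where
  "normalized_gaussian_dist S = gaussian_dist S / sqrt (real CARD('n))"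

definition std_gaussian_matrix :: "'w measure \<Rightarrow> ('w \<Rightarrow> real ^ 'n::finite ^ 'm::finite) \<Rightarrow> bool" where
  "std_gaussian_matrix M A \<longleftrightarrow>
     prob_space.indep_vars M (\<lambda>_. borel) (\<lambda>(i, j) \<omega>. A \<omega> $ i $ j) UNIV \<and>
     (\<forall>i j. distributed M lborel (\<lambda>\<omega>. A \<omega> $ i $ j) std_normal_density)"

end

(* Put y = A^T mu. If x0 is optimal, separating the origin from the convex set of pairs
   (A x - A x0, t) with x in C and t > f x - f x0 yields a multiplier mu with <y, xbar0> = f xbar0 and
   <y, c> <= f c on C. With Lambda the sum of the lam i * L i this gives |proj_C y| <= Lambda, so that
   (f xbar0 / Lambda) |proj_C y| <= |mu| |A xbar0|. For Gaussian A this is unlikely. The norm of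
   A xbar0 has order sqrt m. For a fixed unit vector mu the vector y is standard Gaussian, and
   |proj_C y| concentrates around a mean which is at least of order sqrt (n (1 - D)), because
   |y|^2 = |proj_C y|^2 + dist(y, C)^2 and both summands have square roots of bounded variance;
   a 1/4-net of at most 9^m unit vectors makes this uniform in mu. The hypothesis m <= m_low forces
   n (1 - D) >= 100 m, so every additive constant and the size of the net are absorbed. *)
theory Submission
  imports Defs
begin

section \<open>The standard Gaussian measure\<close>

text \<open>The projection length and the distance to C are sublinear but need not be smooth, so
  concentration cannot be read off from a gradient. Both are support functions of subsets of the
  unit ball (C, respectively its polar cone, intersected with the ball) and so have at each point a
  supporting functional of norm at most 1. This one-sided linear bound is all that the Maurey-Pisier
  rotation argument uses once the rotation is cut into finitely many steps; it gives tails
  exp(-t^2/5) and variance at most 6. Hence one locale serves both terms of the Pythagoras identity.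
  The Gaussian distance enters through D^2 <= D for 0 <= D <= 1: since E dist(y, C) = D sqrt n, the
  squared mean of the projection length is at least n - n D^2 - 12 >= n (1 - D) - 12. The
  quantitative difficulty is to fit the net exponent log 9, the deviation on the net and the tail of
  |A xbar0| under the factor 100 at once.\<close>

definition std_gauss :: "'a::euclidean_space measure" where
  "std_gauss = density lborel (\<lambda>x. ennreal (\<Prod>b\<in>Basis. std_normal_density (x \<bullet> b)))"

definition gauss_density :: "'a::euclidean_space \<Rightarrow> real" where
  "gauss_density x = exp (- (norm x)\<^sup>2 / 2) / sqrt (2 * pi) ^ DIM('a)"

lemma prod_std_normal_density:
  "(\<Prod>b\<in>Basis. std_normal_density (x \<bullet> b)) = gauss_density (x::'a::euclidean_space)"
proof -
  have "(\<Prod>b\<in>Basis. std_normal_density (x \<bullet> b)) = (\<Prod>b\<in>(Basis::'a set). exp (- (x \<bullet> b)\<^sup>2 / 2)) / sqrt (2 * pi) ^ DIM('a)"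
    by (simp add: std_normal_density_def prod_dividef prod.distrib)
  also have "(\<Prod>b\<in>(Basis::'a set). exp (- (x \<bullet> b)\<^sup>2 / 2)) = exp (- (norm x)\<^sup>2 / 2)"
    by (simp add: exp_sum[symmetric] sum_negf sum_divide_distrib[symmetric] norm_eq_sqrt_inner euclidean_inner[of x x] power2_eq_square sum_nonneg)
  finally show ?thesis by (simp add: gauss_density_def)
qed

lemma std_gauss_eq: "std_gauss = density lborel (\<lambda>x. ennreal (gauss_density x))"
  by (simp add: std_gauss_def prod_std_normal_density)

lemma sets_std_gauss [simp, measurable_cong]: "sets std_gauss = sets borel"
  and space_std_gauss [simp]: "space std_gauss = UNIV"
  by (simp_all add: std_gauss_def)

lemma gauss_density_nonneg [simp]: "0 \<le> gauss_density x"
  by (simp add: gauss_density_def)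

lemma measurable_gauss_density [measurable]: "gauss_density \<in> borel_measurable borel"
  unfolding gauss_density_def by measurable

lemma nn_integral_std_gauss:
  "f \<in> borel_measurable borel \<Longrightarrow>
    (\<integral>\<^sup>+x. f x \<partial>std_gauss) = (\<integral>\<^sup>+x. ennreal (gauss_density x) * f x \<partial>lborel)"
  by (simp add: std_gauss_eq nn_integral_density)

text \<open>Fubini over the coordinates along \<open>Basis\<close>: each factor absorbs its own
  one-dimensional density.\<close>

lemma nn_integral_std_gauss_prod:
  assumes [measurable]: "\<And>b. b \<in> Basis \<Longrightarrow> f b \<in> borel_measurable borel"
  assumes f: "\<And>b x. b \<in> Basis \<Longrightarrow> 0 \<le> (f b x :: real)"
  shows "(\<integral>\<^sup>+x. ennreal (\<Prod>b\<in>(Basis::'a::euclidean_space set). f b (x \<bullet> b)) \<partial>std_gauss) =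
    (\<Prod>b\<in>(Basis::'a set). \<integral>\<^sup>+x. ennreal (f b x) \<partial>density lborel std_normal_density)"
proof -
  have "(\<integral>\<^sup>+x. ennreal (\<Prod>b\<in>(Basis::'a set). f b (x \<bullet> b)) \<partial>std_gauss) =
    (\<integral>\<^sup>+x. (\<Prod>b\<in>(Basis::'a set). ennreal (std_normal_density (x \<bullet> b) * f b (x \<bullet> b))) \<partial>lborel)"
    using f by (simp add: nn_integral_density std_gauss_def prod_ennreal prod_nonneg ennreal_mult[symmetric] prod.distrib[symmetric])
  also have "\<dots> = (\<Prod>b\<in>(Basis::'a set). \<integral>\<^sup>+x. ennreal (std_normal_density x * f b x) \<partial>lborel)"
    using f by (intro nn_integral_lborel_prod) auto
  also have "\<dots> = (\<Prod>b\<in>(Basis::'a set). \<integral>\<^sup>+x. ennreal (f b x) \<partial>density lborel std_normal_density)"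
    using f by (intro prod.cong refl) (simp add: nn_integral_density ennreal_mult)
  finally show ?thesis .
qed

lemma prob_space_std_normal: "prob_space (density lborel std_normal_density)"
  by (intro prob_space_normal_density) simp

lemma prob_space_std_gauss: "prob_space (std_gauss :: 'a::euclidean_space measure)"
proof
  interpret prob_space "density lborel std_normal_density" by (rule prob_space_std_normal)
  have "(\<integral>\<^sup>+(x::'a). ennreal (\<Prod>b\<in>(Basis::'a set). 1) \<partial>std_gauss) = 1"
    using emeasure_space_1 nn_integral_std_gauss_prod[of "\<lambda>_::'a. \<lambda>_. 1"] by simp
  then show "emeasure (std_gauss::'a measure) (space std_gauss) = 1" by simp
qed

interpretation std_gauss: prob_space "std_gauss :: 'a::euclidean_space measure"
  by (rule prob_space_std_gauss)

lemma prod_Basis_vec: "(\<Prod>b\<in>(Basis :: (real ^ 'n::finite) set). g b) = (\<Prod>i\<in>UNIV. g (axis i 1))"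
proof -
  have B: "(Basis :: (real ^ 'n) set) = (\<lambda>i. axis i 1) ` UNIV" by (auto simp: Basis_vec_def)
  have "inj (\<lambda>i::'n. axis i (1::real))" by (auto simp: inj_on_def axis_eq_axis)
  then show ?thesis unfolding B by (simp only: prod.reindex comp_def)
qed

text \<open>Links \<open>std_gauss\<close> to the product measure in which
  \<open>gaussian_dist\<close> is expressed; agreement on rectangles is enough.\<close>

lemma distr_std_gauss_PiM:
  "distr (std_gauss :: (real ^ 'n::finite) measure) (\<Pi>\<^sub>M i\<in>UNIV. density lborel std_normal_density) (\<lambda>x i. x $ i)
    = (\<Pi>\<^sub>M i\<in>UNIV. density lborel std_normal_density)"
proof -
  let ?N = "\<lambda>_::'n. density lborel (\<lambda>x. ennreal (std_normal_density x))"
  interpret N: prob_space "density lborel (\<lambda>x. ennreal (std_normal_density x))" by (rule prob_space_std_normal)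
  interpret P: product_sigma_finite ?N by standard
  let ?R = "\<lambda>x::real ^ 'n. \<lambda>i. x $ i"
  have R[measurable]: "?R \<in> borel \<rightarrow>\<^sub>M PiM UNIV ?N"
    by (rule measurable_PiM_single') auto
  show ?thesis
  proof (rule P.PiM_eqI)
    fix A :: "'n \<Rightarrow> real set" assume A': "\<And>i. i \<in> UNIV \<Longrightarrow> A i \<in> sets (?N i)"
    then have A[measurable]: "\<And>i. A i \<in> sets borel" by simp
    have S: "Pi\<^sub>E UNIV A \<in> sets (PiM UNIV ?N)" by (rule sets_PiM_I_finite) (use A in simp_all)
    have "emeasure (distr std_gauss (PiM UNIV ?N) ?R) (Pi\<^sub>E UNIV A)
      = emeasure std_gauss (?R -` Pi\<^sub>E UNIV A)"
      using R S by (subst emeasure_distr) simp_all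
    also have "\<dots> = (\<integral>\<^sup>+x. indicator (?R -` Pi\<^sub>E UNIV A) x \<partial>std_gauss)"
      using measurable_sets[OF R S] by (intro nn_integral_indicator[symmetric]) simp
    \<comment> \<open>The product formula is indexed by basis vectors, the sides \<open>A\<close> by
      coordinates; \<open>THE i. b = axis i 1\<close> recovers the coordinate from the
      vector.\<close>
    also have "\<dots> = (\<integral>\<^sup>+x. ennreal (\<Prod>b\<in>(Basis :: (real ^ 'n) set). indicat_real (A (THE i. b = axis i 1)) (x \<bullet> b)) \<partial>std_gauss)"
    proof (rule nn_integral_cong)
      fix x :: "real ^ 'n"
      have "indicat_real (?R -` Pi\<^sub>E UNIV A) x = (\<Prod>i\<in>UNIV. indicat_real (A i) (x $ i))"
      proof (cases "\<forall>i. x $ i \<in> A i")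
        case False
        then obtain i where "x $ i \<notin> A i" by auto
        then have "(\<Prod>i\<in>UNIV. indicat_real (A i) (x $ i)) = 0"
          by (intro prod_zero bexI[of _ i]) auto
        with False show ?thesis by (auto simp: PiE_iff)
      qed (simp add: PiE_iff)
      then show "indicator (?R -` Pi\<^sub>E UNIV A) x = ennreal (\<Prod>b\<in>(Basis :: (real ^ 'n) set). indicat_real (A (THE i. b = axis i 1)) (x \<bullet> b))"
        by (simp add: prod_Basis_vec axis_eq_axis inner_axis ennreal_indicator[symmetric])
    qed
    also have "\<dots> = (\<Prod>b\<in>(Basis :: (real ^ 'n) set). emeasure (density lborel std_normal_density) (A (THE i. b = axis i 1)))"
      by (subst nn_integral_std_gauss_prod) (simp_all add: ennreal_indicator)
    also have "\<dots> = (\<Prod>i\<in>UNIV. emeasure (?N i) (A i))"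
      by (simp add: prod_Basis_vec axis_eq_axis)
    finally show "emeasure (distr std_gauss (PiM UNIV ?N) ?R) (Pi\<^sub>E UNIV A) = (\<Prod>i\<in>UNIV. emeasure (?N i) (A i))" .
  qed simp_all
qed

lemma measurable_vec_lambda_PiM:
  "(\<lambda>f. \<chi> i. f i) \<in> (\<Pi>\<^sub>M i\<in>(UNIV :: 'n::finite set). density lborel std_normal_density) \<rightarrow>\<^sub>M (borel :: (real ^ 'n) measure)"
proof (rule borel_measurable_euclidean_space[THEN iffD2], rule ballI)
  fix b :: "real ^ 'n" assume "b \<in> Basis"
  then obtain i where b: "b = axis i 1" by (auto simp: Basis_vec_def)
  have "(\<lambda>f. f i) \<in> (\<Pi>\<^sub>M i\<in>(UNIV :: 'n::finite set). density lborel std_normal_density) \<rightarrow>\<^sub>M density lborel std_normal_density"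
    by (rule measurable_component_singleton) simp
  then show "(\<lambda>f. (\<chi> i. f i) \<bullet> b) \<in> borel_measurable (\<Pi>\<^sub>M i\<in>(UNIV :: 'n::finite set). density lborel std_normal_density)"
    by (simp add: b inner_axis)
qed

lemma std_gauss_eq_distr_PiM:
  "distr (\<Pi>\<^sub>M i\<in>(UNIV :: 'n::finite set). density lborel std_normal_density) borel (\<lambda>f. \<chi> i. f i)
    = (std_gauss :: (real ^ 'n) measure)"
proof -
  have "distr (distr (std_gauss :: (real ^ 'n) measure) (\<Pi>\<^sub>M i\<in>UNIV. density lborel std_normal_density) (\<lambda>x i. x $ i)) borel (\<lambda>f. \<chi> i. f i)
    = distr std_gauss borel ((\<lambda>f. \<chi> i. f i) \<circ> (\<lambda>x i. x $ i))"
    by (intro distr_distr measurable_vec_lambda_PiM measurable_PiM_single') auto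
  also have "(\<lambda>f. \<chi> i. f i) \<circ> (\<lambda>x i. x $ i) = (\<lambda>x::real ^ 'n. x)"
    by (simp add: fun_eq_iff)
  also have "distr std_gauss borel (\<lambda>x. x) = std_gauss"
    by (simp add: distr_id2)
  finally show ?thesis by (simp add: distr_std_gauss_PiM)
qed

lemma (in prob_space) distr_indep_std_normal:
  fixes X :: "'a \<Rightarrow> real ^ 'n::finite"
  assumes ind: "indep_vars (\<lambda>_. borel) (\<lambda>i \<omega>. X \<omega> $ i) UNIV"
    and d: "\<And>i. distributed M lborel (\<lambda>\<omega>. X \<omega> $ i) std_normal_density"
  shows "distr M borel X = std_gauss"
proof -
  let ?N = "\<lambda>_::'n. density lborel (\<lambda>x. ennreal (std_normal_density x))"
  have X: "(\<lambda>\<omega>. X \<omega> $ i) \<in> borel_measurable M" for i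
  proof -
    have "(\<lambda>\<omega>. X \<omega> $ i) \<in> M \<rightarrow>\<^sub>M lborel" by (rule distributed_measurable[OF d])
    then show ?thesis by (simp only: measurable_lborel1)
  qed
  let ?R = "\<lambda>\<omega>. \<lambda>i\<in>UNIV. X \<omega> $ i"
  have R: "?R \<in> M \<rightarrow>\<^sub>M (\<Pi>\<^sub>M i\<in>UNIV. borel)" using X by (intro measurable_restrict)
  have "distr M (\<Pi>\<^sub>M i\<in>UNIV. borel) ?R = (\<Pi>\<^sub>M i\<in>UNIV. distr M borel (\<lambda>\<omega>. X \<omega> $ i))"
    by (rule indep_vars_iff_distr_eq_PiM'[THEN iffD1, OF _ _ ind]) (use X in auto)
  also have "\<dots> = PiM UNIV ?N"
  proof (rule PiM_cong)
    fix i :: 'n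
    have "distr M borel (\<lambda>\<omega>. X \<omega> $ i) = distr M lborel (\<lambda>\<omega>. X \<omega> $ i)" by (rule distr_cong) auto
    then show "distr M borel (\<lambda>\<omega>. X \<omega> $ i) = ?N i" by (simp only: distributed_distr_eq_density[OF d])
  qed simp
  finally have *: "distr M (\<Pi>\<^sub>M i\<in>UNIV. borel) ?R = PiM UNIV ?N" .
  have "sets (\<Pi>\<^sub>M i\<in>UNIV. borel) = sets (PiM UNIV ?N)" by (intro sets_PiM_cong) auto
  then have "std_gauss = distr (distr M (\<Pi>\<^sub>M i\<in>UNIV. borel) ?R) borel (\<lambda>f. \<chi> i. f i)"
    by (simp only: * std_gauss_eq_distr_PiM)
  also have "\<dots> = distr M borel ((\<lambda>f. \<chi> i. f i) \<circ> ?R)"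
    by (intro distr_distr[OF _ R]) (simp only: measurable_cong_sets[OF \<open>sets _ = _\<close> refl] measurable_vec_lambda_PiM)
  also have "(\<lambda>f. \<chi> i. f i) \<circ> ?R = X"
    by (simp add: fun_eq_iff vec_eq_iff)
  finally show ?thesis ..
qed

lemma nn_integral_std_normal_square:
  "(\<integral>\<^sup>+y. ennreal (y\<^sup>2) \<partial>density lborel std_normal_density) = 1"
proof -
  have "(\<integral>\<^sup>+y. ennreal (y\<^sup>2) \<partial>density lborel std_normal_density) = (\<integral>\<^sup>+y. ennreal (std_normal_density y * y\<^sup>2) \<partial>lborel)"
    by (simp add: nn_integral_density ennreal_mult)
  also have "\<dots> = 1"
    using normal_moment_even[of 1 0 1] by (subst nn_integral_eq_integral) (auto simp: has_bochner_integral_iff)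
  finally show ?thesis .
qed

lemma nn_integral_std_gauss_norm_square:
  "(\<integral>\<^sup>+x. ennreal ((norm x)\<^sup>2) \<partial>(std_gauss :: 'a::euclidean_space measure)) = ennreal (real DIM('a))"
proof -
  interpret N: prob_space "density lborel (\<lambda>x. ennreal (std_normal_density x))" by (rule prob_space_std_normal)
  have *: "(\<integral>\<^sup>+x. ennreal ((x \<bullet> b)\<^sup>2) \<partial>(std_gauss :: 'a measure)) = 1" if b: "b \<in> Basis" for b :: 'a
  proof -
    let ?f = "\<lambda>b' y. if b' = b then y\<^sup>2 else (1::real)"
    have "(\<integral>\<^sup>+x. ennreal ((x \<bullet> b)\<^sup>2) \<partial>(std_gauss :: 'a measure)) = (\<integral>\<^sup>+x. ennreal (\<Prod>b'\<in>Basis. ?f b' (x \<bullet> b')) \<partial>(std_gauss :: 'a measure))"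
      using b by (intro nn_integral_cong) (simp add: prod.delta)
    also have "\<dots> = (\<Prod>b'\<in>(Basis::'a set). \<integral>\<^sup>+y. ennreal (?f b' y) \<partial>density lborel std_normal_density)"
      by (rule nn_integral_std_gauss_prod) auto
    also have "\<dots> = (\<Prod>b'\<in>(Basis::'a set). 1)"
    proof (rule prod.cong)
      fix b' :: 'a
      show "(\<integral>\<^sup>+y. ennreal (?f b' y) \<partial>density lborel std_normal_density) = 1"
        using nn_integral_std_normal_square N.emeasure_space_1 by (cases "b' = b") simp_all
    qed simp
    finally show ?thesis by simp
  qed
  have "(\<integral>\<^sup>+x. ennreal ((norm x)\<^sup>2) \<partial>(std_gauss :: 'a measure)) = (\<integral>\<^sup>+x. (\<Sum>b\<in>Basis. ennreal ((x \<bullet> b)\<^sup>2)) \<partial>(std_gauss :: 'a measure))"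
    by (intro nn_integral_cong) (simp add: power2_norm_eq_inner, subst euclidean_inner, simp add: power2_eq_square)
  also have "\<dots> = (\<Sum>b\<in>(Basis::'a set). 1)"
    by (subst nn_integral_sum) (simp_all add: *)
  finally show ?thesis by (simp add: ennreal_of_nat_eq_real_of_nat)
qed

lemma integral_std_gauss_norm_square:
  "integrable (std_gauss :: 'a::euclidean_space measure) (\<lambda>x. (norm x)\<^sup>2)"
  "(\<integral>x. (norm x)\<^sup>2 \<partial>(std_gauss :: 'a::euclidean_space measure)) = real DIM('a)"
proof -
  show "integrable (std_gauss :: 'a measure) (\<lambda>x. (norm x)\<^sup>2)"
    by (rule integrableI_bounded) (simp_all add: nn_integral_std_gauss_norm_square)
  show "(\<integral>x. (norm x)\<^sup>2 \<partial>(std_gauss :: 'a measure)) = real DIM('a)"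
    by (subst integral_eq_nn_integral) (simp_all add: nn_integral_std_gauss_norm_square)
qed

lemma (in prob_space) distributed_unit_combination:
  fixes X :: "'p \<Rightarrow> 'a \<Rightarrow> real"
  assumes I: "finite I" and ind: "indep_vars (\<lambda>_. borel) X I"
    and d: "\<And>p. p \<in> I \<Longrightarrow> distributed M lborel (X p) std_normal_density"
    and v: "(\<Sum>p\<in>I. (v p)\<^sup>2) = 1"
  shows "distributed M lborel (\<lambda>\<omega>. \<Sum>p\<in>I. v p * X p \<omega>) std_normal_density"
proof -
  \<comment> \<open>Zero coefficients are dropped because the sum rule for independent normals wants
    positive standard deviations; the unit sum of squares keeps \<open>?J\<close> nonempty.\<close>
  let ?J = "{p\<in>I. v p \<noteq> 0}"
  have sq: "(\<Sum>p\<in>?J. (v p)\<^sup>2) = 1"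
    using I v by (subst sum.mono_neutral_left[of I]) auto
  have "indep_vars (\<lambda>_. borel) X ?J" by (rule indep_vars_subset[OF ind]) auto
  then have "indep_vars (\<lambda>_. borel) (\<lambda>p \<omega>. v p * X p \<omega>) ?J"
    by (rule indep_vars_compose2[where Y="\<lambda>p x. v p * x"]) auto
  moreover have "distributed M lborel (\<lambda>\<omega>. v p * X p \<omega>) (normal_density 0 \<bar>v p\<bar>)" if "p \<in> ?J" for p
    using normal_density_affine[OF d, of p "v p" 0] that by simp
  moreover have "?J \<noteq> {}" using sq by (metis sum.empty zero_neq_one)
  ultimately have "distributed M lborel (\<lambda>\<omega>. \<Sum>p\<in>?J. v p * X p \<omega>) (normal_density (\<Sum>p\<in>?J. 0) (sqrt (\<Sum>p\<in>?J. \<bar>v p\<bar>\<^sup>2)))"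
    using I by (intro sum_indep_normal) auto
  moreover have "(\<lambda>\<omega>. \<Sum>p\<in>?J. v p * X p \<omega>) = (\<lambda>\<omega>. \<Sum>p\<in>I. v p * X p \<omega>)"
    using I by (intro ext sum.mono_neutral_left) auto
  ultimately show ?thesis by (simp add: sq)
qed

text \<open>Serves both products of a Gaussian matrix with a unit vector: the blocks
  \<open>K r\<close> are the rows for \<open>A \<omega> *v x\<close> and the columns for
  \<open>\<mu> v* A \<omega>\<close>. Disjoint blocks make the resulting coordinates
  independent.\<close>

lemma (in prob_space) distr_unit_combinations:
  fixes X :: "'p::finite \<Rightarrow> 'a \<Rightarrow> real" and K :: "'n::finite \<Rightarrow> 'p set"
  assumes ind: "indep_vars (\<lambda>_. borel) X UNIV"
    and d: "\<And>p. distributed M lborel (X p) std_normal_density"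
    and K: "disjoint_family K"
    and v: "\<And>r. (\<Sum>p\<in>K r. (v p)\<^sup>2) = 1"
  shows "distr M borel (\<lambda>\<omega>. \<chi> r. \<Sum>p\<in>K r. v p * X p \<omega>) = std_gauss"
proof (rule distr_indep_std_normal)
  have "indep_vars (\<lambda>r. PiM (K r) (\<lambda>_. borel)) (\<lambda>r \<omega>. restrict (\<lambda>p. X p \<omega>) (K r)) UNIV"
    using K by (intro indep_vars_restrict[OF ind]) auto
  then have "indep_vars (\<lambda>_. borel) (\<lambda>r \<omega>. \<Sum>p\<in>K r. v p * restrict (\<lambda>p. X p \<omega>) (K r) p) UNIV"
    by (rule indep_vars_compose2[where Y="\<lambda>r f. \<Sum>p\<in>K r. v p * f p"]) measurable
  then show "indep_vars (\<lambda>_. borel) (\<lambda>r \<omega>. (\<chi> r. \<Sum>p\<in>K r. v p * X p \<omega>) $ r) UNIV" by simp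
  fix r
  have "distributed M lborel (\<lambda>\<omega>. \<Sum>p\<in>K r. v p * X p \<omega>) std_normal_density"
    using v d by (intro distributed_unit_combination indep_vars_subset[OF ind]) auto
  then show "distributed M lborel (\<lambda>\<omega>. (\<chi> r. \<Sum>p\<in>K r. v p * X p \<omega>) $ r) std_normal_density" by simp
qed

lemma distr_matrix_vector_mult:
  fixes A :: "'w \<Rightarrow> real ^ 'n::finite ^ 'm::finite"
  assumes "prob_space M" and A: "std_gaussian_matrix M A" and x: "norm x = 1"
  shows "distr M borel (\<lambda>\<omega>. A \<omega> *v x) = std_gauss"
proof -
  interpret prob_space M by fact
  let ?X = "\<lambda>(i, j) \<omega>. A \<omega> $ i $ j" and ?K = "\<lambda>i::'m. {i} \<times> (UNIV::'n set)"
  have S: "(\<Sum>p\<in>?K i. g p) = (\<Sum>j\<in>UNIV. g (i, j))" for i and g :: "'m \<times> 'n \<Rightarrow> real"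
    by (simp add: sum.cartesian_product' case_prod_beta)
  have "distr M borel (\<lambda>\<omega>. \<chi> r. \<Sum>p\<in>?K r. (x $ snd p) * ?X p \<omega>) = std_gauss"
  proof (rule distr_unit_combinations)
    show "indep_vars (\<lambda>_. borel) ?X UNIV" using A by (simp add: std_gaussian_matrix_def)
    show "distributed M lborel (?X p) std_normal_density" for p
      using A by (simp add: std_gaussian_matrix_def split_beta)
    have "(\<Sum>j\<in>UNIV. (x $ j)\<^sup>2) = 1"
      using x by (simp add: norm_eq_1 inner_vec_def power2_eq_square)
    then show "(\<Sum>p\<in>?K r. (x $ snd p)\<^sup>2) = 1" for r by (simp add: S)
  qed (auto simp: disjoint_family_on_def)
  moreover have "A \<omega> *v x = (\<chi> r. \<Sum>p\<in>?K r. (x $ snd p) * ?X p \<omega>)" for \<omega>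
    by (simp add: S matrix_vector_mult_def mult.commute)
  ultimately show ?thesis by simp
qed

lemma distr_vector_matrix_mult:
  fixes A :: "'w \<Rightarrow> real ^ 'n::finite ^ 'm::finite"
  assumes "prob_space M" and A: "std_gaussian_matrix M A" and \<mu>: "norm \<mu> = 1"
  shows "distr M borel (\<lambda>\<omega>. \<mu> v* A \<omega>) = std_gauss"
proof -
  interpret prob_space M by fact
  let ?X = "\<lambda>(i, j) \<omega>. A \<omega> $ i $ j" and ?K = "\<lambda>j::'n. (UNIV::'m set) \<times> {j}"
  have S: "(\<Sum>p\<in>?K j. g p) = (\<Sum>i\<in>UNIV. g (i, j))" for j and g :: "'m \<times> 'n \<Rightarrow> real"
    by (simp add: sum.cartesian_product' case_prod_beta)
  have "distr M borel (\<lambda>\<omega>. \<chi> r. \<Sum>p\<in>?K r. (\<mu> $ fst p) * ?X p \<omega>) = std_gauss"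
  proof (rule distr_unit_combinations)
    show "indep_vars (\<lambda>_. borel) ?X UNIV" using A by (simp add: std_gaussian_matrix_def)
    show "distributed M lborel (?X p) std_normal_density" for p
      using A by (simp add: std_gaussian_matrix_def split_beta)
    have "(\<Sum>j\<in>UNIV. (\<mu> $ j)\<^sup>2) = 1"
      using \<mu> by (simp add: norm_eq_1 inner_vec_def power2_eq_square)
    then show "(\<Sum>p\<in>?K r. (\<mu> $ fst p)\<^sup>2) = 1" for r by (simp add: S)
  qed (auto simp: disjoint_family_on_def)
  moreover have "\<mu> v* A \<omega> = (\<chi> r. \<Sum>p\<in>?K r. (\<mu> $ fst p) * ?X p \<omega>)" for \<omega>
    by (simp add: S vector_matrix_mult_def mult.commute)
  ultimately show ?thesis by simp
qed

section \<open>Exponential moments of the Gaussian by affine substitution\<close>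

lemma nn_integral_lborel_affine:
  fixes f :: "'a::euclidean_space \<Rightarrow> ennreal"
  assumes [measurable]: "f \<in> borel_measurable borel" and c: "c \<noteq> 0"
  shows "(\<integral>\<^sup>+x. f x \<partial>lborel) = ennreal (\<bar>c\<bar> ^ DIM('a)) * (\<integral>\<^sup>+x. f (t + c *\<^sub>R x) \<partial>lborel)"
  by (subst lborel_affine[OF c, of t]) (simp add: nn_integral_density nn_integral_distr nn_integral_cmult)

lemma nn_integral_gauss_density: "(\<integral>\<^sup>+x. ennreal (gauss_density (x::'a::euclidean_space)) \<partial>lborel) = 1"
  using nn_integral_std_gauss[of "\<lambda>_::'a. 1"] std_gauss.emeasure_space_1[where 'a='a] by simp

text \<open>Dilation by \<open>c = 1 / sqrt (1 - a)\<close> turns the integrand back into the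
  Gaussian density, so only the Jacobian remains.\<close>

lemma nn_integral_std_gauss_exp_norm:
  assumes "a < 1"
  shows "(\<integral>\<^sup>+x. ennreal (exp (a * (norm x)\<^sup>2 / 2)) \<partial>(std_gauss :: 'a::euclidean_space measure)) =
    ennreal ((1 / sqrt (1 - a)) ^ DIM('a))"
proof -
  define c where "c = 1 / sqrt (1 - a)"
  have c: "c > 0" "c\<^sup>2 * (1 - a) = 1" using assms by (simp_all add: c_def power_divide)
  have eq: "gauss_density (c *\<^sub>R x) * exp (a * (norm (c *\<^sub>R x))\<^sup>2 / 2) = gauss_density x" for x :: 'a
  proof -
    have "- (c\<^sup>2 * (norm x)\<^sup>2) / 2 + a * (c\<^sup>2 * (norm x)\<^sup>2) / 2 = - (c\<^sup>2 * (1 - a)) * (norm x)\<^sup>2 / 2"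
      by (simp add: field_simps)
    then have "- (norm (c *\<^sub>R x))\<^sup>2 / 2 + a * (norm (c *\<^sub>R x))\<^sup>2 / 2 = - (norm x)\<^sup>2 / 2"
      using c by (simp add: power_mult_distrib)
    then have "exp (- (norm (c *\<^sub>R x))\<^sup>2 / 2) * exp (a * (norm (c *\<^sub>R x))\<^sup>2 / 2) = exp (- (norm x)\<^sup>2 / 2)"
      by (metis exp_add)
    then show ?thesis unfolding gauss_density_def by (simp add: divide_simps)
  qed
  have "(\<integral>\<^sup>+x. ennreal (exp (a * (norm x)\<^sup>2 / 2)) \<partial>(std_gauss :: 'a measure)) =
    (\<integral>\<^sup>+(x::'a). ennreal (gauss_density x * exp (a * (norm x)\<^sup>2 / 2)) \<partial>lborel)"
    by (subst nn_integral_std_gauss) (simp_all add: ennreal_mult)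
  also have "\<dots> = ennreal (\<bar>c\<bar> ^ DIM('a)) * (\<integral>\<^sup>+(x::'a). ennreal (gauss_density x) \<partial>lborel)"
    using c by (subst nn_integral_lborel_affine[where c=c and t=0]) (simp_all add: eq del: norm_scaleR)
  finally show ?thesis using c by (simp add: nn_integral_gauss_density c_def)
qed

text \<open>Completing the square: translation by \<open>a\<close> restores the density up to a
  constant factor.\<close>

lemma nn_integral_std_gauss_exp_inner:
  "(\<integral>\<^sup>+x. ennreal (exp (a \<bullet> x)) \<partial>std_gauss) = ennreal (exp ((norm (a::'a::euclidean_space))\<^sup>2 / 2))"
proof -
  have eq: "gauss_density (a + x) * exp (a \<bullet> (a + x)) = exp ((norm a)\<^sup>2 / 2) * gauss_density x" for x
  proof -
    have "- (norm (a + x))\<^sup>2 / 2 + a \<bullet> (a + x) = (norm a)\<^sup>2 / 2 + - (norm x)\<^sup>2 / 2"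
      by (simp add: power2_norm_eq_inner inner_add inner_commute field_simps)
    then have "exp (- (norm (a + x))\<^sup>2 / 2) * exp (a \<bullet> (a + x)) = exp ((norm a)\<^sup>2 / 2) * exp (- (norm x)\<^sup>2 / 2)"
      by (metis exp_add)
    then show ?thesis unfolding gauss_density_def by (simp add: divide_simps)
  qed
  have "(\<integral>\<^sup>+x. ennreal (exp (a \<bullet> x)) \<partial>std_gauss) = (\<integral>\<^sup>+x. ennreal (gauss_density x * exp (a \<bullet> x)) \<partial>lborel)"
    by (subst nn_integral_std_gauss) (simp_all add: ennreal_mult)
  also have "\<dots> = (\<integral>\<^sup>+(x::'a). ennreal (exp ((norm a)\<^sup>2 / 2)) * ennreal (gauss_density x) \<partial>lborel)"
    by (subst nn_integral_lborel_affine[where c=1 and t=a]) (simp_all add: eq ennreal_mult)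
  finally show ?thesis by (simp add: nn_integral_cmult nn_integral_gauss_density)
qed

section \<open>Rotations of a pair of independent Gaussian vectors\<close>

definition rot :: "real \<Rightarrow> 'a \<times> 'a \<Rightarrow> 'a \<times> 'a::real_vector" where
  "rot \<theta> z = (cos \<theta> *\<^sub>R fst z + sin \<theta> *\<^sub>R snd z, cos \<theta> *\<^sub>R snd z - sin \<theta> *\<^sub>R fst z)"

lemma rot_rot: "rot \<alpha> (rot \<beta> z) = rot (\<alpha> + \<beta>) z"
  by (simp add: rot_def prod_eq_iff cos_add sin_add algebra_simps)

lemma rot_0 [simp]: "rot 0 z = z"
  by (simp add: rot_def)

lemma measurable_rot [measurable]:
  "(rot \<theta> :: 'a \<times> 'a \<Rightarrow> 'a \<times> 'a::euclidean_space) \<in> borel \<Otimes>\<^sub>M borel \<rightarrow>\<^sub>M borel \<Otimes>\<^sub>M borel"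
  unfolding rot_def by measurable

lemma gauss_density_rotate:
  assumes "c\<^sup>2 + s\<^sup>2 = 1"
  shows "gauss_density (c *\<^sub>R u - s *\<^sub>R v) * gauss_density (s *\<^sub>R u + c *\<^sub>R v) =
    gauss_density u * gauss_density (v :: 'a::euclidean_space)"
proof -
  have "(norm (c *\<^sub>R u - s *\<^sub>R v))\<^sup>2 + (norm (s *\<^sub>R u + c *\<^sub>R v))\<^sup>2 = (c\<^sup>2 + s\<^sup>2) * (norm u)\<^sup>2 + (c\<^sup>2 + s\<^sup>2) * (norm v)\<^sup>2"
    by (simp only: power2_norm_eq_inner inner_add inner_diff inner_scaleR_left inner_scaleR_right)
       (simp add: power2_eq_square inner_commute algebra_simps)
  then have "- (norm (c *\<^sub>R u - s *\<^sub>R v))\<^sup>2 / 2 + - (norm (s *\<^sub>R u + c *\<^sub>R v))\<^sup>2 / 2 = - (norm u)\<^sup>2 / 2 + - (norm v)\<^sup>2 / 2"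
    using assms by simp
  then have "exp (- (norm (c *\<^sub>R u - s *\<^sub>R v))\<^sup>2 / 2) * exp (- (norm (s *\<^sub>R u + c *\<^sub>R v))\<^sup>2 / 2) = exp (- (norm u)\<^sup>2 / 2) * exp (- (norm v)\<^sup>2 / 2)"
    by (metis exp_add)
  then show ?thesis unfolding gauss_density_def by (simp add: divide_simps)
qed

text \<open>The substitutions x = (u - s y)/c and then y = s u + c v have Jacobians that cancel.\<close>
lemma nn_integral_std_gauss_rot:
  fixes f :: "'a::euclidean_space \<times> 'a \<Rightarrow> ennreal"
  assumes f[measurable]: "f \<in> borel_measurable (borel \<Otimes>\<^sub>M borel)" and "cos \<theta> \<noteq> 0"
  shows "(\<integral>\<^sup>+z. f (rot \<theta> z) \<partial>(std_gauss \<Otimes>\<^sub>M std_gauss)) = (\<integral>\<^sup>+z. f z \<partial>(std_gauss \<Otimes>\<^sub>M std_gauss))"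
proof -
  define c s where "c = cos \<theta>" and "s = sin \<theta>"
  have c: "c \<noteq> 0" using assms by (simp add: c_def)
  have cs: "c\<^sup>2 + s\<^sup>2 = 1" by (simp add: c_def s_def)
  let ?g = "\<lambda>x::'a. ennreal (gauss_density x)"
  have M[measurable_cong]: "sets (std_gauss :: 'a measure) = sets borel" by simp
  have pair: "(\<integral>\<^sup>+z. h z \<partial>(std_gauss \<Otimes>\<^sub>M std_gauss)) = (\<integral>\<^sup>+x. \<integral>\<^sup>+y. ?g x * ?g y * h (x, y) \<partial>lborel \<partial>lborel)"
    if [measurable]: "h \<in> borel_measurable (borel \<Otimes>\<^sub>M borel)" for h :: "'a \<times> 'a \<Rightarrow> ennreal"
    by (subst std_gauss.nn_integral_fst[symmetric], measurable)
       (simp add: nn_integral_std_gauss nn_integral_cmult[symmetric] mult.assoc)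
  have "(\<integral>\<^sup>+z. f (rot \<theta> z) \<partial>(std_gauss \<Otimes>\<^sub>M std_gauss)) =
     (\<integral>\<^sup>+x. \<integral>\<^sup>+y. ?g x * ?g y * f (c *\<^sub>R x + s *\<^sub>R y, c *\<^sub>R y - s *\<^sub>R x) \<partial>lborel \<partial>lborel)"
    by (subst pair) (simp_all add: rot_def c_def s_def)
  also have "\<dots> = (\<integral>\<^sup>+y. \<integral>\<^sup>+x. ?g x * ?g y * f (c *\<^sub>R x + s *\<^sub>R y, c *\<^sub>R y - s *\<^sub>R x) \<partial>lborel \<partial>lborel)"
    by (rule lborel_pair.Fubini'[symmetric]) measurable
  also have "\<dots> = (\<integral>\<^sup>+y. ennreal (\<bar>1 / c\<bar> ^ DIM('a)) * (\<integral>\<^sup>+u. ?g ((1/c) *\<^sub>R (u - s *\<^sub>R y)) * ?g y * f (u, (1/c) *\<^sub>R (y - s *\<^sub>R u)) \<partial>lborel) \<partial>lborel)"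
  proof (rule nn_integral_cong)
    fix y :: 'a
    let ?h = "\<lambda>x. ?g x * ?g y * f (c *\<^sub>R x + s *\<^sub>R y, c *\<^sub>R y - s *\<^sub>R x)"
    have "(\<integral>\<^sup>+x. ?h x \<partial>lborel) = ennreal (\<bar>1 / c\<bar> ^ DIM('a)) * (\<integral>\<^sup>+u. ?h ((- s / c) *\<^sub>R y + (1/c) *\<^sub>R u) \<partial>lborel)"
      by (rule nn_integral_lborel_affine) (use c in \<open>measurable, simp\<close>)
    also have "(\<lambda>u. ?h ((- s / c) *\<^sub>R y + (1/c) *\<^sub>R u)) = (\<lambda>u. ?g ((1/c) *\<^sub>R (u - s *\<^sub>R y)) * ?g y * f (u, (1/c) *\<^sub>R (y - s *\<^sub>R u)))"
    proof
      fix u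
      have 1: "(- s / c) *\<^sub>R y + (1/c) *\<^sub>R u = (1/c) *\<^sub>R (u - s *\<^sub>R y)"
        by (simp add: algebra_simps)
      have 2: "c *\<^sub>R ((1/c) *\<^sub>R (u - s *\<^sub>R y)) + s *\<^sub>R y = u"
        using c by (simp add: algebra_simps)
      have 3: "c *\<^sub>R y - s *\<^sub>R ((1/c) *\<^sub>R (u - s *\<^sub>R y)) = (1/c) *\<^sub>R (y - s *\<^sub>R u)"
      proof -
        have "c *\<^sub>R y - s *\<^sub>R ((1/c) *\<^sub>R (u - s *\<^sub>R y)) = ((c\<^sup>2 + s\<^sup>2) / c) *\<^sub>R y - (s / c) *\<^sub>R u"
          using c by (simp add: algebra_simps add_divide_distrib power2_eq_square)
        also have "\<dots> = (1/c) *\<^sub>R (y - s *\<^sub>R u)" unfolding cs by (simp add: algebra_simps)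
        finally show ?thesis .
      qed
      show "?h ((- s / c) *\<^sub>R y + (1/c) *\<^sub>R u) = ?g ((1/c) *\<^sub>R (u - s *\<^sub>R y)) * ?g y * f (u, (1/c) *\<^sub>R (y - s *\<^sub>R u))"
        by (simp only: 1 2 3)
    qed
    finally show "(\<integral>\<^sup>+x. ?h x \<partial>lborel) = ennreal (\<bar>1 / c\<bar> ^ DIM('a)) * (\<integral>\<^sup>+u. ?g ((1/c) *\<^sub>R (u - s *\<^sub>R y)) * ?g y * f (u, (1/c) *\<^sub>R (y - s *\<^sub>R u)) \<partial>lborel)" .
  qed
  also have "\<dots> = ennreal (\<bar>1 / c\<bar> ^ DIM('a)) * (\<integral>\<^sup>+y. \<integral>\<^sup>+u. ?g ((1/c) *\<^sub>R (u - s *\<^sub>R y)) * ?g y * f (u, (1/c) *\<^sub>R (y - s *\<^sub>R u)) \<partial>lborel \<partial>lborel)"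
    by (rule nn_integral_cmult) measurable
  also have "(\<integral>\<^sup>+y. \<integral>\<^sup>+u. ?g ((1/c) *\<^sub>R (u - s *\<^sub>R y)) * ?g y * f (u, (1/c) *\<^sub>R (y - s *\<^sub>R u)) \<partial>lborel \<partial>lborel) =
     (\<integral>\<^sup>+u. \<integral>\<^sup>+y. ?g ((1/c) *\<^sub>R (u - s *\<^sub>R y)) * ?g y * f (u, (1/c) *\<^sub>R (y - s *\<^sub>R u)) \<partial>lborel \<partial>lborel)"
    by (rule lborel_pair.Fubini') measurable
  also have "\<dots> = (\<integral>\<^sup>+u. ennreal (\<bar>c\<bar> ^ DIM('a)) * (\<integral>\<^sup>+v. ?g u * ?g v * f (u, v) \<partial>lborel) \<partial>lborel)"
  proof (rule nn_integral_cong)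
    fix u :: 'a
    let ?h = "\<lambda>y. ?g ((1/c) *\<^sub>R (u - s *\<^sub>R y)) * ?g y * f (u, (1/c) *\<^sub>R (y - s *\<^sub>R u))"
    have "(\<integral>\<^sup>+y. ?h y \<partial>lborel) = ennreal (\<bar>c\<bar> ^ DIM('a)) * (\<integral>\<^sup>+v. ?h (s *\<^sub>R u + c *\<^sub>R v) \<partial>lborel)"
    proof (rule nn_integral_lborel_affine[OF _ c])
      have "(\<lambda>x. (u, (1/c) *\<^sub>R (x - s *\<^sub>R u))) \<in> borel \<rightarrow>\<^sub>M borel \<Otimes>\<^sub>M borel" by measurable
      from measurable_compose[OF this f] show "?h \<in> borel_measurable borel" by measurable
    qed
    also have "(\<lambda>v. ?h (s *\<^sub>R u + c *\<^sub>R v)) = (\<lambda>v. ?g u * ?g v * f (u, v))"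
    proof
      fix v
      have 1: "(1/c) *\<^sub>R ((s *\<^sub>R u + c *\<^sub>R v) - s *\<^sub>R u) = v"
        using c by (simp add: algebra_simps)
      have "(1/c) *\<^sub>R (u - s *\<^sub>R (s *\<^sub>R u + c *\<^sub>R v)) = ((1 - s\<^sup>2) / c) *\<^sub>R u - s *\<^sub>R v"
        using c by (simp add: algebra_simps diff_divide_distrib power2_eq_square)
      also have "1 - s\<^sup>2 = c\<^sup>2" using cs by simp
      finally have 2: "(1/c) *\<^sub>R (u - s *\<^sub>R (s *\<^sub>R u + c *\<^sub>R v)) = c *\<^sub>R u - s *\<^sub>R v"
        using c by (simp add: power2_eq_square)
      show "?h (s *\<^sub>R u + c *\<^sub>R v) = ?g u * ?g v * f (u, v)"
        unfolding 1 2 by (simp add: ennreal_mult[symmetric] gauss_density_rotate[OF cs])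
    qed
    finally show "(\<integral>\<^sup>+y. ?h y \<partial>lborel) = ennreal (\<bar>c\<bar> ^ DIM('a)) * (\<integral>\<^sup>+v. ?g u * ?g v * f (u, v) \<partial>lborel)" .
  qed
  also have "\<dots> = ennreal (\<bar>c\<bar> ^ DIM('a)) * (\<integral>\<^sup>+u. \<integral>\<^sup>+v. ?g u * ?g v * f (u, v) \<partial>lborel \<partial>lborel)"
    by (rule nn_integral_cmult) measurable
  also have "(\<integral>\<^sup>+u. \<integral>\<^sup>+v. ?g u * ?g v * f (u, v) \<partial>lborel \<partial>lborel) = (\<integral>\<^sup>+z. f z \<partial>(std_gauss \<Otimes>\<^sub>M std_gauss))"
    by (subst pair) simp_all
  also have "ennreal (\<bar>1 / c\<bar> ^ DIM('a)) * (ennreal (\<bar>c\<bar> ^ DIM('a)) * \<dots>) = \<dots>"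
    using c by (simp add: mult.assoc[symmetric] ennreal_mult[symmetric] power_mult_distrib[symmetric])
  finally show ?thesis .
qed

text \<open>The substitutions divide by the cosine, which vanishes at the right angle, and that
  angle is the endpoint of the rotation used below. Two rotations by \<open>\<theta> / 2\<close>
  avoid the zero.\<close>

lemma nn_integral_std_gauss_rot_quarter:
  fixes f :: "'a::euclidean_space \<times> 'a \<Rightarrow> ennreal"
  assumes [measurable]: "f \<in> borel_measurable (borel \<Otimes>\<^sub>M borel)" and "0 \<le> \<theta>" "\<theta> \<le> pi / 2"
  shows "(\<integral>\<^sup>+z. f (rot \<theta> z) \<partial>(std_gauss \<Otimes>\<^sub>M std_gauss)) = (\<integral>\<^sup>+z. f z \<partial>(std_gauss \<Otimes>\<^sub>M std_gauss))"
proof -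
  have "cos (\<theta> / 2) > 0" using assms pi_gt_zero by (intro cos_gt_zero_pi) linarith+
  then have "cos (\<theta> / 2) \<noteq> 0" by simp
  note r = nn_integral_std_gauss_rot[OF _ this]
  have "(\<integral>\<^sup>+z. f (rot \<theta> z) \<partial>(std_gauss \<Otimes>\<^sub>M std_gauss)) = (\<integral>\<^sup>+z. f (rot (\<theta> / 2) (rot (\<theta> / 2) z)) \<partial>(std_gauss \<Otimes>\<^sub>M std_gauss))"
    by (simp add: rot_rot)
  also have "\<dots> = (\<integral>\<^sup>+z. f (rot (\<theta> / 2) z) \<partial>(std_gauss \<Otimes>\<^sub>M std_gauss))"
    by (rule r[where f="\<lambda>z. f (rot (\<theta> / 2) z)"]) measurable
  also have "\<dots> = (\<integral>\<^sup>+z. f z \<partial>(std_gauss \<Otimes>\<^sub>M std_gauss))"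
    by (rule r) measurable
  finally show ?thesis .
qed

section \<open>Concentration of sublinear functionals\<close>

text \<open>The cubic Taylor polynomial stays below exp because the remainder has an even power; its
  odd terms cancel in the symmetric sum. The bound lets exponential moments dominate first and
  second moments.\<close>

lemma exp_plus_exp_minus_ge: "2 + y\<^sup>2 \<le> exp y + exp (- y :: real)"
proof -
  have *: "1 + y + y\<^sup>2 / 2 + y ^ 3 / 6 \<le> exp y" for y :: real
  proof -
    obtain t where "exp y = (\<Sum>m<4. y ^ m / fact m) + exp t / fact 4 * y ^ 4"
      using Maclaurin_exp_le[of y 4] by auto
    moreover have "exp t / fact 4 * y ^ 4 \<ge> 0" by (intro mult_nonneg_nonneg) auto
    ultimately show ?thesis by (simp add: eval_nat_numeral)
  qed
  show ?thesis using *[of y] *[of "- y"] by simp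
qed

lemma one_minus_cos_le: "1 - cos x \<le> x\<^sup>2 / (2::real)"
proof -
  have "1 - cos x = 2 * (sin (x / 2))\<^sup>2" using cos_double_sin[of "x / 2"] by simp
  also have "(sin (x / 2))\<^sup>2 \<le> (x / 2)\<^sup>2" using abs_sin_x_le_abs_x[of "x / 2"] by (simp only: abs_le_square_iff)
  finally show ?thesis by (simp add: power2_eq_square)
qed

lemma pi_square_less_10: "pi\<^sup>2 < 10"
proof -
  have "pi\<^sup>2 \<le> 3.15\<^sup>2" using pi_approx by (intro power_mono) auto
  then show ?thesis by (simp add: power2_eq_square)
qed

text \<open>Support functions of subsets of the unit ball, with \<open>s\<close> a measurable choice
  of maximiser that stands in for the gradient. \<open>norm_s\<close> is an inequality because in
  both instances \<open>s x\<close> is 0 where F vanishes.\<close>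

locale sublinear_unit =
  fixes F :: "'a::euclidean_space \<Rightarrow> real" and s :: "'a \<Rightarrow> 'a"
  assumes measurable_s [measurable]: "s \<in> borel_measurable borel"
    and norm_s: "norm (s x) \<le> 1"
    and F_eq: "F x = s x \<bullet> x"
    and F_ge: "s x \<bullet> y \<le> F y"
begin

lemma measurable_F [measurable]: "F \<in> borel_measurable borel"
proof -
  have "F = (\<lambda>x. s x \<bullet> x)" using F_eq by (rule ext)
  moreover have "(\<lambda>x. s x \<bullet> x) \<in> borel_measurable borel" by measurable
  ultimately show ?thesis by simp
qed

lemma F_add_le: "F (x + y) \<le> F x + F y"
  using F_ge[of "x + y" x] F_ge[of "x + y" y] by (simp add: F_eq[of "x + y"] inner_add)

lemma F_scaleR:
  assumes "0 \<le> c"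
  shows "F (c *\<^sub>R x) = c * F x"
proof (cases "c = 0")
  case True then show ?thesis by (simp add: F_eq[of 0])
next
  case False
  then have c: "c > 0" using assms by simp
  have "c * F x \<le> F (c *\<^sub>R x)" using F_ge[of x "c *\<^sub>R x"] by (simp add: F_eq[of x])
  moreover have "F (c *\<^sub>R x) / c \<le> F x"
    using F_ge[of "c *\<^sub>R x" x] c by (simp add: F_eq[of "c *\<^sub>R x"])
  ultimately show ?thesis using c by (simp add: field_simps)
qed

lemma abs_F_le: "\<bar>F x\<bar> \<le> norm x"
proof -
  have "\<bar>s x \<bullet> x\<bar> \<le> norm (s x) * norm x" by (rule Cauchy_Schwarz_ineq2)
  also have "\<dots> \<le> 1 * norm x" by (intro mult_right_mono norm_s) simp
  finally show ?thesis by (simp add: F_eq[of x])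
qed

lemma F_le: "F x \<le> norm x"
  using abs_F_le[of x] by simp

lemma integrable_exp: "integrable std_gauss (\<lambda>x. exp (u * F x))"
proof (rule integrableI_bounded)
  have "(\<integral>\<^sup>+x. ennreal (norm (exp (u * F x))) \<partial>std_gauss) \<le>
    (\<integral>\<^sup>+x. ennreal (exp (u\<^sup>2)) * ennreal (exp ((1/2) * (norm x)\<^sup>2 / 2)) \<partial>(std_gauss :: 'a measure))"
  proof (rule nn_integral_mono)
    fix x :: 'a
    have "u * F x \<le> \<bar>u\<bar> * norm x"
      using mult_left_mono[OF abs_F_le[of x], of "\<bar>u\<bar>"] by (simp add: abs_mult[symmetric])
    \<comment> \<open>Expands (|u| - |x|/2)^2 >= 0; the coefficient 1/2 of the quadratic exponent
      must stay below 1 for the moment to be finite.\<close>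
    also have "\<dots> \<le> u\<^sup>2 + (1/2) * (norm x)\<^sup>2 / 2"
      using zero_le_power2[of "\<bar>u\<bar> - norm x / 2"] by (simp add: power2_eq_square algebra_simps)
    finally have "exp (u * F x) \<le> exp (u\<^sup>2) * exp ((1/2) * (norm x)\<^sup>2 / 2)"
      by (simp only: exp_add[symmetric] exp_le_cancel_iff)
    then show "ennreal (norm (exp (u * F x))) \<le> ennreal (exp (u\<^sup>2)) * ennreal (exp ((1/2) * (norm x)\<^sup>2 / 2))"
      by (simp add: ennreal_mult[symmetric])
  qed
  also have "\<dots> = ennreal (exp (u\<^sup>2)) * ennreal ((1 / sqrt (1 - 1/2)) ^ DIM('a))"
    by (subst nn_integral_cmult) (simp_all only: nn_integral_std_gauss_exp_norm[of "1/2"], simp_all)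
  also have "\<dots> < \<infinity>" by (simp add: ennreal_mult_less_top)
  finally show "(\<integral>\<^sup>+x. ennreal (norm (exp (u * F x))) \<partial>std_gauss) < \<infinity>" .
qed simp

lemma integrable_F: "integrable std_gauss F"
proof (rule Bochner_Integration.integrable_bound)
  show "integrable std_gauss (\<lambda>x. exp (1 * F x) + exp ((-1) * F x))"
    by (intro Bochner_Integration.integrable_add integrable_exp)
  show "AE x in std_gauss. norm (F x) \<le> norm (exp (1 * F x) + exp ((-1) * F x))"
  proof (rule AE_I2)
    fix x
    have "2 * \<bar>F x\<bar> \<le> 2 + (F x)\<^sup>2"
      using zero_le_power2[of "\<bar>F x\<bar> - 1"] by (simp add: power2_eq_square algebra_simps)
    then show "norm (F x) \<le> norm (exp (1 * F x) + exp ((-1) * F x))"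
      using exp_plus_exp_minus_ge[of "F x"] by (auto simp: abs_if add_pos_pos not_less)
  qed
qed simp

lemma integrable_F_square: "integrable std_gauss (\<lambda>x. (F x)\<^sup>2)"
proof (rule Bochner_Integration.integrable_bound)
  show "integrable std_gauss (\<lambda>x. exp (1 * F x) + exp ((-1) * F x))"
    by (intro Bochner_Integration.integrable_add integrable_exp)
  show "AE x in std_gauss. norm ((F x)\<^sup>2) \<le> norm (exp (1 * F x) + exp ((-1) * F x))"
  proof (rule AE_I2)
    fix x
    show "norm ((F x)\<^sup>2) \<le> norm (exp (1 * F x) + exp ((-1) * F x))"
      using exp_plus_exp_minus_ge[of "F x"] by (auto simp: abs_if add_pos_pos not_less)
  qed
qed simp

section \<open>Linearised increments along the rotation\<close>

definition linear_increment :: "real \<Rightarrow> 'a \<times> 'a \<Rightarrow> real" where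
  "linear_increment \<delta> z = (1 - cos \<delta>) * F (fst z) + sin \<delta> * (s (fst z) \<bullet> snd z)"

lemma measurable_linear_increment [measurable]: "linear_increment \<delta> \<in> borel_measurable (borel \<Otimes>\<^sub>M borel)"
  unfolding linear_increment_def by measurable

text \<open>The earlier point is the later point p rotated back by \<open>\<delta>\<close>, and the
  functional supporting F at p bounds F there from below. The result involves F at
  \<open>fst p\<close> plus a term linear in \<open>snd p\<close>, which is independent of
  \<open>fst p\<close>.\<close>

lemma F_rot_le: "F (fst (rot (\<theta> + \<delta>) z)) - F (fst (rot \<theta> z)) \<le> linear_increment \<delta> (rot (\<theta> + \<delta>) z)"
proof -
  define p where "p = rot (\<theta> + \<delta>) z"
  have "rot \<theta> z = rot (- \<delta>) p" by (simp add: p_def rot_rot)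
  then have "fst (rot \<theta> z) = cos \<delta> *\<^sub>R fst p - sin \<delta> *\<^sub>R snd p" by (simp add: rot_def)
  then have "s (fst p) \<bullet> (cos \<delta> *\<^sub>R fst p - sin \<delta> *\<^sub>R snd p) \<le> F (fst (rot \<theta> z))"
    using F_ge by metis
  then have "cos \<delta> * F (fst p) - sin \<delta> * (s (fst p) \<bullet> snd p) \<le> F (fst (rot \<theta> z))"
    by (simp add: inner_diff F_eq[of "fst p"])
  then show ?thesis unfolding linear_increment_def p_def[symmetric] by (simp add: algebra_simps)
qed

text \<open>Telescoping over K equal steps from angle 0, where the first component is
  \<open>fst z\<close>, to pi/2, where it is \<open>snd z\<close>. The angle carries
  \<open>Suc k\<close> because each step is linearised at its later end.\<close>

lemma F_diff_le_sum:
  assumes "K > 0"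
  shows "F (snd z) - F (fst z) \<le> (\<Sum>k<K. linear_increment (pi / (2 * real K)) (rot (real (Suc k) * (pi / (2 * real K))) z))"
proof -
  let ?d = "pi / (2 * real K)"
  have "(\<Sum>k<K. F (fst (rot (real (Suc k) * ?d) z)) - F (fst (rot (real k * ?d) z))) =
     F (fst (rot (real K * ?d) z)) - F (fst (rot (real 0 * ?d) z))"
    by (rule sum_lessThan_telescope)
  also have "\<dots> = F (snd z) - F (fst z)" using assms by (simp add: rot_def)
  finally have *: "F (snd z) - F (fst z) = (\<Sum>k<K. F (fst (rot (real (Suc k) * ?d) z)) - F (fst (rot (real k * ?d) z)))" ..
  show ?thesis unfolding *
  proof (rule sum_mono)
    fix k
    have "real (Suc k) * ?d = real k * ?d + ?d" by (simp only: of_nat_Suc distrib_right mult_1_left add.commute)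
    then show "F (fst (rot (real (Suc k) * ?d) z)) - F (fst (rot (real k * ?d) z)) \<le> linear_increment ?d (rot (real (Suc k) * ?d) z)"
      using F_rot_le[of "real k * ?d" ?d z] by simp
  qed
qed

text \<open>Given the first component, the second enters linearly with a coefficient of norm at most
  \<open>b\<close> and integrates to at most exp(b^2/2). The drift with factor 1 - cos is of second
  order in the step; \<open>\<eta>\<close> bounds it and later tends to 0.\<close>

lemma nn_integral_exp_linear_increment:
  assumes "a \<ge> 0" "0 \<le> \<eta>" "\<eta> < 1" "a * (1 - cos \<delta>) \<le> \<eta>" "\<bar>a * sin \<delta>\<bar> \<le> b"
  shows "(\<integral>\<^sup>+z. ennreal (exp (a * linear_increment \<delta> z)) \<partial>(std_gauss \<Otimes>\<^sub>M std_gauss)) \<le>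
    ennreal (exp (b\<^sup>2 / 2) * (exp (\<eta> / 2) * (1 / sqrt (1 - \<eta>)) ^ DIM('a)))"
proof -
  have "(\<integral>\<^sup>+z. ennreal (exp (a * linear_increment \<delta> z)) \<partial>(std_gauss \<Otimes>\<^sub>M std_gauss)) =
    (\<integral>\<^sup>+x. \<integral>\<^sup>+y. ennreal (exp (a * linear_increment \<delta> (x, y))) \<partial>std_gauss \<partial>std_gauss)"
    by (rule std_gauss.nn_integral_fst[symmetric]) measurable
  also have "\<dots> = (\<integral>\<^sup>+x. \<integral>\<^sup>+y. ennreal (exp (a * (1 - cos \<delta>) * F x)) * ennreal (exp (((a * sin \<delta>) *\<^sub>R s x) \<bullet> y)) \<partial>std_gauss \<partial>std_gauss)"
    by (intro nn_integral_cong) (simp add: linear_increment_def ennreal_mult[symmetric] exp_add[symmetric] algebra_simps)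
  also have "\<dots> = (\<integral>\<^sup>+x. ennreal (exp (a * (1 - cos \<delta>) * F x)) * ennreal (exp ((norm ((a * sin \<delta>) *\<^sub>R s x))\<^sup>2 / 2)) \<partial>std_gauss)"
    by (intro nn_integral_cong) (subst nn_integral_cmult, simp, simp only: nn_integral_std_gauss_exp_inner)
  also have "\<dots> \<le> (\<integral>\<^sup>+x. ennreal (exp (b\<^sup>2 / 2) * exp (\<eta> / 2)) * ennreal (exp (\<eta> * (norm x)\<^sup>2 / 2)) \<partial>(std_gauss :: 'a measure))"
  proof (rule nn_integral_mono)
    fix x :: 'a
    have "a * (1 - cos \<delta>) * F x \<le> a * (1 - cos \<delta>) * norm x"
      using assms by (intro mult_left_mono F_le) auto
    also have "\<dots> \<le> \<eta> * norm x" using assms by (intro mult_right_mono) auto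
    \<comment> \<open>The norm is traded for its square so that the closed form of the quadratic
      moment applies.\<close>
    also have "\<dots> \<le> \<eta> * ((1 + (norm x)\<^sup>2) / 2)"
      using assms zero_le_power2[of "norm x - 1"] by (intro mult_left_mono) (auto simp: power2_eq_square algebra_simps)
    finally have 1: "a * (1 - cos \<delta>) * F x \<le> \<eta> / 2 + \<eta> * (norm x)\<^sup>2 / 2" by (simp add: field_simps)
    have "norm ((a * sin \<delta>) *\<^sub>R s x) \<le> b * 1"
      unfolding norm_scaleR using assms norm_s[of x] by (intro mult_mono) auto
    then have 2: "(norm ((a * sin \<delta>) *\<^sub>R s x))\<^sup>2 / 2 \<le> b\<^sup>2 / 2"
      by (intro divide_right_mono power_mono) auto
    have "exp (a * (1 - cos \<delta>) * F x) * exp ((norm ((a * sin \<delta>) *\<^sub>R s x))\<^sup>2 / 2) \<le> (exp (b\<^sup>2 / 2) * exp (\<eta> / 2)) * exp (\<eta> * (norm x)\<^sup>2 / 2)"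
      unfolding exp_add[symmetric] exp_le_cancel_iff using 1 2 by linarith
    then show "ennreal (exp (a * (1 - cos \<delta>) * F x)) * ennreal (exp ((norm ((a * sin \<delta>) *\<^sub>R s x))\<^sup>2 / 2)) \<le>
      ennreal (exp (b\<^sup>2 / 2) * exp (\<eta> / 2)) * ennreal (exp (\<eta> * (norm x)\<^sup>2 / 2))"
      by (simp only: ennreal_mult[symmetric] exp_ge_zero mult_nonneg_nonneg ennreal_leI)
  qed
  also have "\<dots> = ennreal (exp (b\<^sup>2 / 2) * exp (\<eta> / 2)) * ennreal ((1 / sqrt (1 - \<eta>)) ^ DIM('a))"
    using assms by (subst nn_integral_cmult) (simp_all add: nn_integral_std_gauss_exp_norm)
  also have "\<dots> = ennreal (exp (b\<^sup>2 / 2) * (exp (\<eta> / 2) * (1 / sqrt (1 - \<eta>)) ^ DIM('a)))"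
    using assms by (simp add: ennreal_mult[symmetric] mult.assoc)
  finally show ?thesis .
qed

text \<open>Discretised Maurey-Pisier argument: rotate (x, y) from x to y in K small steps, bound
  every increment of F by its linearisation, and let K tend to infinity.\<close>
lemma nn_integral_exp_diff_le:
  assumes u: "u \<ge> 0"
  shows "(\<integral>\<^sup>+z. ennreal (exp (u * (F (snd z) - F (fst z)))) \<partial>(std_gauss \<Otimes>\<^sub>M std_gauss)) \<le> ennreal (exp (pi\<^sup>2 * u\<^sup>2 / 8))"
    (is "?I \<le> _")
proof -
  \<comment> \<open>With steps \<delta> = pi/(2K) and the factor K that Jensen will produce, u K (1
    - cos \<delta>) is at most u K \<delta>^2 / 2 = \<open>\<eta> K\<close>, which vanishes in the
    limit, whereas u K sin \<delta> is at most u pi/2 for every K.\<close>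
  define \<eta> where "\<eta> K = u * pi\<^sup>2 / 8 * inverse (real K)" for K
  define B where "B K = exp ((u * pi / 2)\<^sup>2 / 2) * (exp (\<eta> K / 2) * (1 / sqrt (1 - \<eta> K)) ^ DIM('a))" for K
  have \<eta>: "\<eta> \<longlonglongrightarrow> u * pi\<^sup>2 / 8 * 0"
    unfolding \<eta>_def by (intro tendsto_intros lim_inverse_n)
  then have "B \<longlonglongrightarrow> exp ((u * pi / 2)\<^sup>2 / 2) * (exp (0 / 2) * (1 / sqrt (1 - 0)) ^ DIM('a))"
    unfolding B_def by (intro tendsto_intros) auto
  then have lim: "(\<lambda>K. ennreal (B K)) \<longlonglongrightarrow> ennreal (exp (pi\<^sup>2 * u\<^sup>2 / 8))"
    by (intro tendsto_ennrealI) (simp add: power_mult_distrib power_divide mult.commute)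
  have ev: "eventually (\<lambda>K. \<eta> K < 1) sequentially"
    using \<eta> by (rule order_tendstoD) simp
  have "eventually (\<lambda>K. ?I \<le> ennreal (B K)) sequentially"
    using ev eventually_gt_at_top[of 0]
  proof eventually_elim
    case (elim K)
    define \<delta> where "\<delta> = pi / (2 * real K)"
    let ?r = "\<lambda>k. rot (real (Suc k) * \<delta>) :: 'a \<times> 'a \<Rightarrow> 'a \<times> 'a"
    have K: "real K > 0" using elim by simp
    have le: "ennreal (exp (u * (F (snd z) - F (fst z)))) \<le> (\<Sum>k<K. ennreal (1 / real K) * ennreal (exp (u * real K * linear_increment \<delta> (?r k z))))" for z
    proof -
      have "u * (F (snd z) - F (fst z)) \<le> u * (\<Sum>k<K. linear_increment \<delta> (?r k z))"
        unfolding \<delta>_def using elim u by (intro mult_left_mono F_diff_le_sum) auto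
      also have "\<dots> = (\<Sum>k<K. (1 / real K) *\<^sub>R (u * real K * linear_increment \<delta> (?r k z)))"
        using K by (simp add: sum_distrib_left)
      finally have "exp (u * (F (snd z) - F (fst z))) \<le> exp (\<Sum>k<K. (1 / real K) *\<^sub>R (u * real K * linear_increment \<delta> (?r k z)))"
        by simp
      \<comment> \<open>Jensen with K equal weights: only single increments, each scaled by K, have
        to be integrated, and rotation invariance gives all of them the same law.\<close>
      also have "\<dots> \<le> (\<Sum>k<K. (1 / real K) * exp (u * real K * linear_increment \<delta> (?r k z)))"
        using K by (intro convex_on_sum[OF _ _ exp_convex]) auto
      finally have "ennreal (exp (u * (F (snd z) - F (fst z)))) \<le> ennreal (\<Sum>k<K. (1 / real K) * exp (u * real K * linear_increment \<delta> (?r k z)))"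
        by (rule ennreal_leI)
      also have "\<dots> = (\<Sum>k<K. ennreal ((1 / real K) * exp (u * real K * linear_increment \<delta> (?r k z))))"
        by (rule sum_ennreal[symmetric]) simp
      also have "\<dots> = (\<Sum>k<K. ennreal (1 / real K) * ennreal (exp (u * real K * linear_increment \<delta> (?r k z))))"
        by (intro sum.cong refl ennreal_mult) auto
      finally show ?thesis .
    qed
    have "?I \<le> (\<integral>\<^sup>+z. (\<Sum>k<K. ennreal (1 / real K) * ennreal (exp (u * real K * linear_increment \<delta> (?r k z)))) \<partial>(std_gauss \<Otimes>\<^sub>M std_gauss))"
      by (intro nn_integral_mono le)
    also have "\<dots> = (\<Sum>k<K. ennreal (1 / real K) * (\<integral>\<^sup>+z. ennreal (exp (u * real K * linear_increment \<delta> (?r k z))) \<partial>(std_gauss \<Otimes>\<^sub>M std_gauss)))"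
      by (subst nn_integral_sum, measurable) (intro sum.cong refl nn_integral_cmult, measurable)
    also have "\<dots> = (\<Sum>k<K. ennreal (1 / real K) * (\<integral>\<^sup>+z. ennreal (exp (u * real K * linear_increment \<delta> z)) \<partial>(std_gauss \<Otimes>\<^sub>M std_gauss)))"
    proof (intro sum.cong refl arg_cong2[where f="(*)"])
      fix k assume "k \<in> {..<K}"
      then have "real (Suc k) \<le> real K" by simp
      then have "real (Suc k) * \<delta> \<le> real K * \<delta>"
        unfolding \<delta>_def using K by (intro mult_right_mono) auto
      then have "real (Suc k) * \<delta> \<le> pi / 2" using K by (simp add: \<delta>_def)
      moreover have "0 \<le> real (Suc k) * \<delta>" using K by (simp add: \<delta>_def)
      ultimately show "(\<integral>\<^sup>+z. ennreal (exp (u * real K * linear_increment \<delta> (?r k z))) \<partial>(std_gauss \<Otimes>\<^sub>M std_gauss)) =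
         (\<integral>\<^sup>+z. ennreal (exp (u * real K * linear_increment \<delta> z)) \<partial>(std_gauss \<Otimes>\<^sub>M std_gauss))"
        by (intro nn_integral_std_gauss_rot_quarter[where f="\<lambda>z. ennreal (exp (u * real K * linear_increment \<delta> z))"]) measurable
    qed
    also have "\<dots> = (\<integral>\<^sup>+z. ennreal (exp (u * real K * linear_increment \<delta> z)) \<partial>(std_gauss \<Otimes>\<^sub>M std_gauss))"
      using K by (simp add: mult.assoc[symmetric] ennreal_of_nat_eq_real_of_nat ennreal_mult[symmetric])
    also have "\<dots> \<le> ennreal (B K)"
      unfolding B_def
    proof (rule nn_integral_exp_linear_increment)
      show "0 \<le> u * real K" "0 \<le> \<eta> K" "\<eta> K < 1" using u elim by (auto simp: \<eta>_def)
      have "u * real K * (1 - cos \<delta>) \<le> u * real K * (\<delta>\<^sup>2 / 2)"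
        using u by (intro mult_left_mono one_minus_cos_le) auto
      also have "\<dots> = \<eta> K" using K by (simp add: \<eta>_def \<delta>_def power2_eq_square field_simps)
      finally show "u * real K * (1 - cos \<delta>) \<le> \<eta> K" .
      have "\<bar>u * real K * sin \<delta>\<bar> \<le> u * real K * \<bar>\<delta>\<bar>"
        using u abs_sin_x_le_abs_x[of \<delta>] by (simp add: abs_mult mult_left_mono)
      also have "\<dots> = u * pi / 2" using K by (simp add: \<delta>_def)
      finally show "\<bar>u * real K * sin \<delta>\<bar> \<le> u * pi / 2" .
    qed
    finally show ?case .
  qed
  then show ?thesis by (intro tendsto_le[OF _ lim tendsto_const]) auto
qed

section \<open>Moment generating function, tails and variance\<close>

abbreviation mean :: real where "mean \<equiv> \<integral>x. F x \<partial>std_gauss"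

text \<open>Jensen's inequality by way of the tangent line of exp at
  \<open>u * mean\<close>.\<close>

lemma exp_mean_le: "exp (u * mean) \<le> (\<integral>x. exp (u * F x) \<partial>std_gauss)"
proof -
  have "exp (u * mean) = (\<integral>x. exp (u * mean) * (1 + (u * F x - u * mean)) \<partial>std_gauss)"
    using integrable_F by (simp add: std_gauss.prob_space[simplified])
  also have "\<dots> \<le> (\<integral>x. exp (u * F x) \<partial>std_gauss)"
  proof (rule integral_mono)
    fix x
    have "exp (u * mean) * (1 + (u * F x - u * mean)) \<le> exp (u * mean) * exp (u * F x - u * mean)"
      by (intro mult_left_mono exp_ge_add_one_self) simp
    then show "exp (u * mean) * (1 + (u * F x - u * mean)) \<le> exp (u * F x)"
      by (simp add: exp_add[symmetric])
  qed (use integrable_F integrable_exp in auto)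
  finally show ?thesis .
qed

text \<open>The two components are independent, so the exponential moment of the difference
  factorises.\<close>

lemma mgf_prod_le:
  assumes "u \<ge> 0"
  shows "(\<integral>x. exp (u * F x) \<partial>std_gauss) * (\<integral>x. exp (- u * F x) \<partial>std_gauss) \<le> exp (pi\<^sup>2 * u\<^sup>2 / 8)"
proof -
  have nn: "(\<integral>\<^sup>+x. ennreal (exp (v * F x)) \<partial>std_gauss) = ennreal (\<integral>x. exp (v * F x) \<partial>std_gauss)" for v
    by (intro nn_integral_eq_integral integrable_exp) simp
  have "(\<integral>\<^sup>+z. ennreal (exp (u * (F (snd z) - F (fst z)))) \<partial>(std_gauss \<Otimes>\<^sub>M std_gauss)) =
    (\<integral>\<^sup>+x. \<integral>\<^sup>+y. ennreal (exp (u * (F y - F x))) \<partial>std_gauss \<partial>std_gauss)"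
    by (subst std_gauss.nn_integral_fst[symmetric]) simp_all
  also have "\<dots> = (\<integral>\<^sup>+x. \<integral>\<^sup>+y. ennreal (exp (- u * F x)) * ennreal (exp (u * F y)) \<partial>std_gauss \<partial>std_gauss)"
    by (intro nn_integral_cong) (simp add: ennreal_mult[symmetric] exp_add[symmetric] algebra_simps)
  also have "\<dots> = ennreal (\<integral>x. exp (- u * F x) \<partial>std_gauss) * ennreal (\<integral>x. exp (u * F x) \<partial>std_gauss)"
    by (simp add: nn_integral_cmult nn_integral_multc nn nn[of "- u", simplified])
  finally show ?thesis using nn_integral_exp_diff_le[OF assms]
    by (simp add: ennreal_mult[symmetric] mult.commute)
qed

text \<open>By Jensen the factor belonging to -u is at least exp(-u mean) and can be divided out of
  the product bound. The constant 5/4 comes from pi^2/8 and pi^2 < 10; negative u is covered by the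
  product bound at -u.\<close>

lemma mgf_le: "(\<integral>x. exp (u * F x) \<partial>std_gauss) \<le> exp (5 / 4 * u\<^sup>2 + u * mean)"
proof -
  have "(\<integral>x. exp (u * F x) \<partial>std_gauss) * exp (- u * mean) \<le>
     (\<integral>x. exp (u * F x) \<partial>std_gauss) * (\<integral>x. exp (- u * F x) \<partial>std_gauss)"
    by (intro mult_left_mono exp_mean_le) simp
  also have "\<dots> \<le> exp (pi\<^sup>2 * u\<^sup>2 / 8)"
    using mgf_prod_le[of u] mgf_prod_le[of "- u"] by (cases "u \<ge> 0") (auto simp: mult.commute)
  also have "\<dots> \<le> exp (5 / 4 * u\<^sup>2)"
    using mult_right_mono[OF less_imp_le[OF pi_square_less_10], of "u\<^sup>2"] by simp
  finally have "(\<integral>x. exp (u * F x) \<partial>std_gauss) * exp (- u * mean) * exp (u * mean) \<le> exp (5 / 4 * u\<^sup>2) * exp (u * mean)"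
    by (rule mult_right_mono) simp
  then show ?thesis by (simp add: mult.assoc exp_add[symmetric])
qed

lemma upper_tail:
  assumes "t > 0"
  shows "measure std_gauss {x. F x \<ge> mean + t} \<le> exp (- t\<^sup>2 / 5)"
proof -
  \<comment> \<open>The minimiser of 5/4 u^2 - u t, with minimum -t^2/5.\<close>
  define u where "u = 2 * t / 5"
  have u: "u > 0" using assms by (simp add: u_def)
  have "measure std_gauss {x \<in> space std_gauss. F x \<ge> mean + t} \<le> exp (- u * (mean + t)) * (\<integral>x\<in>space std_gauss. exp (u * F x) \<partial>std_gauss)"
    using u integrable_exp by (intro std_gauss.Chernoff_ineq_ge) (auto simp: set_integrable_def)
  also have "(\<integral>x\<in>space std_gauss. exp (u * F x) \<partial>std_gauss) \<le> exp (5 / 4 * u\<^sup>2 + u * mean)"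
    using mgf_le by (simp add: set_lebesgue_integral_def)
  finally have "measure std_gauss {x. F x \<ge> mean + t} \<le> exp (- u * (mean + t)) * exp (5 / 4 * u\<^sup>2 + u * mean)"
    by simp
  also have "\<dots> = exp (- t\<^sup>2 / 5)"
    unfolding exp_add[symmetric] by (simp add: u_def power2_eq_square field_simps)
  finally show ?thesis .
qed

lemma lower_tail:
  assumes "t > 0"
  shows "measure std_gauss {x. F x \<le> mean - t} \<le> exp (- t\<^sup>2 / 5)"
proof -
  define u where "u = 2 * t / 5"
  have u: "u > 0" using assms by (simp add: u_def)
  have "measure std_gauss {x \<in> space std_gauss. F x \<le> mean - t} \<le> exp (u * (mean - t)) * (\<integral>x\<in>space std_gauss. exp (- u * F x) \<partial>std_gauss)"
    using u integrable_exp[of "- u"] by (intro std_gauss.Chernoff_ineq_le) (auto simp: set_integrable_def)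
  also have "(\<integral>x\<in>space std_gauss. exp (- u * F x) \<partial>std_gauss) \<le> exp (5 / 4 * u\<^sup>2 + (- u) * mean)"
    using mgf_le[of "- u"] by (simp add: set_lebesgue_integral_def)
  finally have "measure std_gauss {x. F x \<le> mean - t} \<le> exp (u * (mean - t)) * exp (5 / 4 * u\<^sup>2 + (- u) * mean)"
    by simp
  also have "\<dots> = exp (- t\<^sup>2 / 5)"
    unfolding exp_add[symmetric] by (simp add: u_def power2_eq_square field_simps)
  finally show ?thesis .
qed

text \<open>2 + y^2 <= exp y + exp(-y) is taken at y = F x - mean; the moment bounds at u = 1 and u
  = -1 then give 2 exp(5/4) <= 8, and subtracting 2 leaves 6.\<close>

lemma second_moment_le: "(\<integral>x. (F x)\<^sup>2 \<partial>std_gauss) \<le> mean\<^sup>2 + 6"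
proof -
  let ?G = "\<lambda>x. exp (- mean) * exp (1 * F x) + exp mean * exp ((- 1) * F x)"
  have "(\<integral>x. 2 + (F x - mean)\<^sup>2 \<partial>std_gauss) \<le> (\<integral>x. ?G x \<partial>std_gauss)"
  proof (rule integral_mono)
    show "integrable std_gauss (\<lambda>x. 2 + (F x - mean)\<^sup>2)"
      unfolding power2_diff using integrable_F integrable_F_square by simp
    show "integrable std_gauss ?G"
      by (intro Bochner_Integration.integrable_add integrable_mult_right integrable_exp)
    fix x show "2 + (F x - mean)\<^sup>2 \<le> ?G x"
      using exp_plus_exp_minus_ge[of "F x - mean"] by (simp add: exp_add[symmetric])
  qed
  also have "\<dots> = exp (- mean) * (\<integral>x. exp (1 * F x) \<partial>std_gauss) + exp mean * (\<integral>x. exp ((- 1) * F x) \<partial>std_gauss)"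
    using integrable_exp[of 1] integrable_exp[of "- 1"] by simp
  also have "\<dots> \<le> exp (- mean) * exp (5 / 4 * 1\<^sup>2 + 1 * mean) + exp mean * exp (5 / 4 * (- 1)\<^sup>2 + (- 1) * mean)"
    by (intro add_mono mult_left_mono mgf_le) auto
  also have "\<dots> = 2 * exp (5 / 4)" unfolding exp_add[symmetric] by simp
  also have "exp (5 / 4 :: real) \<le> 4"
  proof -
    have "exp (5 / 4 :: real) ^ 4 = exp 1 ^ 5" by (simp add: exp_of_nat_mult[symmetric])
    also have "\<dots> \<le> 3 ^ 5" by (intro power_mono exp_le) simp
    also have "\<dots> \<le> (4::real) ^ 4" by simp
    finally show ?thesis using power_mono_iff[of "exp (5 / 4)" "4::real" 4] by simp
  qed
  finally have "(\<integral>x. 2 + (F x - mean)\<^sup>2 \<partial>std_gauss) \<le> 8" by simp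
  moreover have "(\<integral>x. 2 + (F x - mean)\<^sup>2 \<partial>std_gauss) = 2 + (\<integral>x. (F x)\<^sup>2 \<partial>std_gauss) - mean\<^sup>2"
    unfolding power2_diff using integrable_F integrable_F_square
    by (simp add: std_gauss.prob_space[simplified] power2_eq_square)
  ultimately show ?thesis by simp
qed

end

section \<open>Projection onto a closed convex cone\<close>

text \<open>For u = 0 the normalised vector is 0 by division by zero; \<open>0 \<le> k\<close>
  settles this case.\<close>

lemma inner_normalized_le:
  fixes u y :: "'a::real_inner"
  assumes "u \<bullet> y \<le> norm u * k" "0 \<le> k"
  shows "(u /\<^sub>R norm u) \<bullet> y \<le> k"
  using assms by (cases "u = 0") (simp_all add: field_simps)

context
  fixes C :: "'a::euclidean_space set"
  assumes C: "closed C" "convex C" "cone C" "C \<noteq> {}"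
begin

lemma closest_point_cone_in: "closest_point C h \<in> C"
  using C by (intro closest_point_in_set)

text \<open>The variational inequality of the projection p, tested at the cone points 0 and 2p,
  gives both signs.\<close>

lemma closest_point_cone_orthogonal: "(h - closest_point C h) \<bullet> closest_point C h = 0"
proof -
  let ?p = "closest_point C h"
  have "0 *\<^sub>R ?p \<in> C" "2 *\<^sub>R ?p \<in> C"
    using C closest_point_cone_in by (auto simp: cone_def simp del: scaleR_zero_left)
  from this[THEN closest_point_dot[OF C(2,1)], of h]
  show ?thesis by (simp add: inner_diff inner_commute)
qed

lemma closest_point_cone_polar:
  assumes "c \<in> C" shows "(h - closest_point C h) \<bullet> c \<le> 0"
  using closest_point_dot[OF C(2,1) assms, of h] closest_point_cone_orthogonal[of h] by (simp add: inner_diff)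

lemma measurable_closest_point_cone [measurable]: "closest_point C \<in> borel_measurable borel"
  using continuous_on_closest_point[OF C(2,1,4), of UNIV] by (rule borel_measurable_continuous_onI)

text \<open>This is the support function of C intersected with the unit ball, attained at the
  normalised projection. In the inequality y may be replaced by its projection, since the residual
  of y has nonpositive inner product with every point of C.\<close>

lemma norm_closest_point_cone_sublinear:
  "sublinear_unit (\<lambda>h. norm (closest_point C h)) (\<lambda>h. closest_point C h /\<^sub>R norm (closest_point C h))"
proof
  fix x y
  let ?p = "closest_point C"
  show "norm (?p x /\<^sub>R norm (?p x)) \<le> 1" by (cases "?p x = 0") simp_all
  have "?p x \<bullet> x = (norm (?p x))\<^sup>2"
    using closest_point_cone_orthogonal[of x] by (simp add: power2_norm_eq_inner inner_diff inner_commute)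
  then show "norm (?p x) = (?p x /\<^sub>R norm (?p x)) \<bullet> x"
    by (cases "?p x = 0") (simp_all add: power2_eq_square)
  have "?p x \<bullet> y \<le> ?p x \<bullet> ?p y"
    using closest_point_cone_polar[OF closest_point_cone_in[of x], of y] by (simp add: inner_diff inner_commute)
  also have "\<dots> \<le> norm (?p x) * norm (?p y)" by (rule norm_cauchy_schwarz)
  finally show "(?p x /\<^sub>R norm (?p x)) \<bullet> y \<le> norm (?p y)"
    by (rule inner_normalized_le) simp
qed measurable

text \<open>The same with the polar cone in the role of C: the residual of x has nonpositive inner
  product with the projection of y.\<close>

lemma dist_closest_point_cone_sublinear:
  "sublinear_unit (\<lambda>h. norm (h - closest_point C h)) (\<lambda>h. (h - closest_point C h) /\<^sub>R norm (h - closest_point C h))"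
proof
  fix x y
  let ?p = "closest_point C"
  show "norm ((x - ?p x) /\<^sub>R norm (x - ?p x)) \<le> 1" by (cases "x = ?p x") simp_all
  have "(x - ?p x) \<bullet> x = (norm (x - ?p x))\<^sup>2"
    using closest_point_cone_orthogonal[of x] by (simp add: power2_norm_eq_inner inner_diff_right)
  then show "norm (x - ?p x) = ((x - ?p x) /\<^sub>R norm (x - ?p x)) \<bullet> x"
    by (cases "x = ?p x") (simp_all add: power2_eq_square)
  have "(x - ?p x) \<bullet> y \<le> (x - ?p x) \<bullet> (y - ?p y)"
    using closest_point_cone_polar[OF closest_point_cone_in[of y], of x] by (simp add: inner_diff_right)
  also have "\<dots> \<le> norm (x - ?p x) * norm (y - ?p y)" by (rule norm_cauchy_schwarz)
  finally show "((x - ?p x) /\<^sub>R norm (x - ?p x)) \<bullet> y \<le> norm (y - ?p y)"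
    by (rule inner_normalized_le) simp
qed measurable

lemma norm_closest_point_cone_pythagoras:
  "(norm h)\<^sup>2 = (norm (closest_point C h))\<^sup>2 + (norm (h - closest_point C h))\<^sup>2"
  using closest_point_cone_orthogonal[of h] by (simp add: power2_norm_eq_inner inner_diff inner_commute)

lemma infdist_closest_point: "infdist h C = norm (h - closest_point C h)"
  using setdist_closest_point[OF C(1,4), of h] C by (simp add: infdist_eq_setdist dist_norm)

end

section \<open>Nets of the sphere\<close>

text \<open>The balls of radius 1/8 about the points are disjoint and lie in the ball of radius 9/8;
  the ratio of the radii is the base 9.\<close>

lemma card_separated_sphere_le:
  fixes S :: "'a::euclidean_space set"
  assumes "finite S" "S \<subseteq> sphere 0 1" and sep: "\<And>x y. x \<in> S \<Longrightarrow> y \<in> S \<Longrightarrow> x \<noteq> y \<Longrightarrow> 1 / 4 < dist x y"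
  shows "card S \<le> 9 ^ DIM('a)"
proof -
  let ?V = "unit_ball_vol (real DIM('a))"
  have "disjoint_family_on (\<lambda>x. ball x (1/8)) S"
  proof (unfold disjoint_family_on_def, intro ballI impI)
    fix x y assume xy: "x \<in> S" "y \<in> S" "x \<noteq> y"
    show "ball x (1/8) \<inter> ball y (1/8) = {}"
    proof (rule ccontr)
      assume "ball x (1/8) \<inter> ball y (1/8) \<noteq> {}"
      then obtain z where "dist x z < 1/8" "dist y z < 1/8" by auto
      then show False using sep[OF xy] dist_triangle[of x y z] by (simp add: dist_commute)
    qed
  qed
  then have "measure lborel (\<Union>x\<in>S. ball x (1/8)) = (\<Sum>x\<in>S. measure lborel (ball x (1/8)))"
    using \<open>finite S\<close> by (intro measure_finite_Union) (auto simp: emeasure_ball)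
  also have "\<dots> = real (card S) * (?V * (1/8) ^ DIM('a))"
    by (simp add: content_ball)
  finally have "real (card S) * (?V * (1/8) ^ DIM('a)) = measure lborel (\<Union>x\<in>S. ball x (1/8))" ..
  also have "\<dots> \<le> measure lborel (ball (0::'a) (9/8))"
  proof (rule measure_mono_fmeasurable)
    show "(\<Union>x\<in>S. ball x (1/8)) \<subseteq> ball 0 (9/8)"
    proof
      fix z assume "z \<in> (\<Union>x\<in>S. ball x (1/8))"
      then obtain x where "x \<in> S" "dist x z < 1/8" by auto
      moreover have "norm x = 1" using \<open>x \<in> S\<close> assms(2) by auto
      ultimately show "z \<in> ball 0 (9/8)"
        using norm_triangle_ineq2[of z x] by (simp add: dist_norm norm_minus_commute)
    qed
    show "ball (0::'a) (9/8) \<in> fmeasurable lborel" by (intro fmeasurableI) (auto simp: emeasure_ball)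
    show "(\<Union>x\<in>S. ball x (1/8)) \<in> sets lborel" by (simp add: open_UN)
  qed
  also have "\<dots> = ?V * (9/8) ^ DIM('a)" by (simp add: content_ball)
  also have "\<dots> = 9 ^ DIM('a) * (?V * (1/8) ^ DIM('a))" by (simp add: power_divide)
  finally have "real (card S) * (?V * (1/8) ^ DIM('a)) \<le> 9 ^ DIM('a) * (?V * (1/8) ^ DIM('a))" .
  then have "real (card S) \<le> 9 ^ DIM('a)"
    by (rule mult_right_le_imp_le) simp
  then show ?thesis by (metis of_nat_le_iff of_nat_numeral of_nat_power)
qed

text \<open>A separated set of greatest cardinality exists by the volume bound and is a net, as an
  uncovered point could be added to it.\<close>

lemma sphere_net:
  obtains T :: "'a::euclidean_space set"
  where "finite T" "T \<subseteq> sphere 0 1" "card T \<le> 9 ^ DIM('a)"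
    "\<And>x. norm x = 1 \<Longrightarrow> \<exists>y\<in>T. norm (x - y) \<le> 1 / 4"
proof -
  let ?P = "\<lambda>S::'a set. finite S \<and> S \<subseteq> sphere 0 1 \<and> (\<forall>x\<in>S. \<forall>y\<in>S. x \<noteq> y \<longrightarrow> 1 / 4 < dist x y)"
  have bound: "card S < Suc (9 ^ DIM('a))" if "?P S" for S
    using that card_separated_sphere_le[of S] by (auto simp: less_Suc_eq_le)
  have "?P {}" by simp
  from ex_has_greatest_nat[of ?P, OF this, of card "Suc (9 ^ DIM('a))"] bound
  obtain T where T: "?P T" and max: "\<And>S. ?P S \<Longrightarrow> card S \<le> card T" by blast
  show ?thesis
  proof
    show "finite T" "T \<subseteq> sphere 0 1" "card T \<le> 9 ^ DIM('a)" using T bound[OF T] by auto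
    fix x :: 'a assume x: "norm x = 1"
    show "\<exists>y\<in>T. norm (x - y) \<le> 1 / 4"
    proof (rule ccontr)
      assume "\<not> (\<exists>y\<in>T. norm (x - y) \<le> 1 / 4)"
      then have far: "\<And>y. y \<in> T \<Longrightarrow> 1 / 4 < dist x y" by (auto simp: dist_norm not_le)
      then have "x \<notin> T" by force
      have "?P (insert x T)" using T x far by (auto simp: dist_commute)
      from max[OF this] T \<open>x \<notin> T\<close> show False by simp
    qed
  qed
qed

text \<open>Let G be the maximum of g on the sphere. Passing to a net point costs at most G/4, so G
  <= b + G/4, that is G <= 4b/3, and then g x >= a - G/4 >= a - b/3. The upper bound
  \<open>b\<close> thus controls the variation of g off the net.\<close>

lemma sublinear_ge_on_sphere:
  fixes g :: "'a::euclidean_space \<Rightarrow> real"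
  assumes nonneg: "\<And>x. 0 \<le> g x" and add: "\<And>x y. g (x + y) \<le> g x + g y"
    and scale: "\<And>c x. 0 \<le> c \<Longrightarrow> g (c *\<^sub>R x) = c * g x"
    and cont: "continuous_on UNIV g"
    and net: "\<And>x. norm x = 1 \<Longrightarrow> \<exists>y\<in>T. norm (x - y) \<le> 1 / 4"
    and T: "\<And>y. y \<in> T \<Longrightarrow> a \<le> g y" "\<And>y. y \<in> T \<Longrightarrow> g y \<le> b"
    and x: "norm x = 1"
  shows "a - b / 3 \<le> g x"
proof -
  have "sphere (0::'a) 1 \<noteq> {}" using x by auto
  then obtain z where z: "norm z = 1" and max: "\<And>y. norm y = 1 \<Longrightarrow> g y \<le> g z"
    using continuous_attains_sup[of "sphere (0::'a) 1" g] continuous_on_subset[OF cont] by auto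
  have g_le: "g v \<le> g z / 4" if "norm v \<le> 1 / 4" for v
  proof (cases "v = 0")
    case True then show ?thesis using scale[of 0 0] nonneg[of z] by simp
  next
    case False
    have "g v = norm v * g (v /\<^sub>R norm v)"
      using scale[of "norm v" "v /\<^sub>R norm v"] False by simp
    also have "\<dots> \<le> (1 / 4) * g z" using that False nonneg by (intro mult_mono max) auto
    finally show ?thesis by simp
  qed
  obtain y where "y \<in> T" "norm (z - y) \<le> 1 / 4" using net[OF z] by auto
  then have "g z \<le> b + g z / 4" using add[of y "z - y"] T(2)[of y] g_le[of "z - y"] by simp
  then have gz: "g z \<le> 4 * b / 3" by simp
  obtain y where y: "y \<in> T" "norm (x - y) \<le> 1 / 4" using net[OF x] by auto
  then have "g y \<le> g x + g z / 4" using add[of x "y - x"] g_le[of "y - x"] by (simp add: norm_minus_commute)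
  then show ?thesis using T(1)[OF y(1)] gz by simp
qed

section \<open>Norms and their Lipschitz constants\<close>

lemma is_normD:
  assumes "is_norm N"
  shows "0 \<le> N x" "N x = 0 \<longleftrightarrow> x = 0" "N (c *\<^sub>R x) = \<bar>c\<bar> * N x" "N (x + y) \<le> N x + N y"
  using assms by (auto simp: is_norm_def)

lemma is_norm_diff_le:
  assumes "is_norm N" shows "N x - N y \<le> N (x - y)"
  using is_normD(4)[OF assms, of y "x - y"] by simp

text \<open>A crude constant is enough: it bounds the Lipschitz quotients above, so that their
  \<open>Sup\<close> is a genuine upper bound, and it gives continuity.\<close>

lemma is_norm_le_norm:
  fixes N :: "'a::euclidean_space \<Rightarrow> real"
  assumes N: "is_norm N"
  shows "N x \<le> (\<Sum>b\<in>Basis. N b) * norm x"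
proof -
  have sum: "N (\<Sum>b\<in>S. g b) \<le> (\<Sum>b\<in>S. N (g b))" if "finite S" for S and g :: "'a \<Rightarrow> 'a"
    using that
  proof induction
    case empty then show ?case using is_normD(2)[OF N, of 0] by simp
  next
    case (insert b S)
    then show ?case using is_normD(4)[OF N, of "g b" "sum g S"] by simp
  qed
  have "N x = N (\<Sum>b\<in>Basis. (x \<bullet> b) *\<^sub>R b)" by (simp add: euclidean_representation)
  also have "\<dots> \<le> (\<Sum>b\<in>Basis. N ((x \<bullet> b) *\<^sub>R b))" by (rule sum) simp
  also have "\<dots> \<le> (\<Sum>b\<in>Basis. N b * norm x)"
    by (intro sum_mono) (simp add: is_normD(3)[OF N] is_normD(1)[OF N] Basis_le_norm mult.commute mult_left_mono)
  finally show ?thesis by (simp add: sum_distrib_right)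
qed

lemma continuous_on_is_norm:
  fixes N :: "'a::euclidean_space \<Rightarrow> real"
  assumes N: "is_norm N"
  shows "continuous_on S N"
proof -
  define K where "K = (\<Sum>b\<in>Basis. N b)"
  have "K \<ge> 0" unfolding K_def by (intro sum_nonneg is_normD(1)[OF N])
  have "\<bar>N x - N y\<bar> \<le> K * norm (x - y)" for x y
    using is_norm_diff_le[OF N, of x y] is_norm_diff_le[OF N, of y x] is_norm_le_norm[OF N, of "x - y"]
      is_norm_le_norm[OF N, of "y - x"]
    by (simp add: K_def norm_minus_commute abs_le_iff)
  then have "K-lipschitz_on S N" using \<open>K \<ge> 0\<close> by (intro lipschitz_onI) (auto simp: dist_norm)
  then show ?thesis by (rule lipschitz_on_continuous_on)
qed

lemma is_norm_le_lipschitz_const: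
  fixes N :: "'a::euclidean_space \<Rightarrow> real"
  assumes N: "is_norm N"
  shows "N x \<le> lipschitz_const N * norm x"
proof (cases "x = 0")
  case True then show ?thesis using is_normD(2)[OF N, of 0] by simp
next
  case False
  have "N x / norm x \<le> lipschitz_const N"
    unfolding lipschitz_const_def
  proof (rule cSup_upper)
    show "N x / norm x \<in> {(N z1 - N z2) / norm (z1 - z2) |z1 z2. z1 \<noteq> z2}"
      using False is_normD(2)[OF N, of 0] by (intro CollectI exI[of _ x] exI[of _ 0]) simp
    show "bdd_above {(N z1 - N z2) / norm (z1 - z2) |z1 z2. z1 \<noteq> z2}"
    proof (rule bdd_aboveI, clarify)
      fix z1 z2 :: 'a assume "z1 \<noteq> z2"
      have "N z1 - N z2 \<le> (\<Sum>b\<in>Basis. N b) * norm (z1 - z2)"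
        using is_norm_diff_le[OF N, of z1 z2] is_norm_le_norm[OF N, of "z1 - z2"] by simp
      then show "(N z1 - N z2) / norm (z1 - z2) \<le> (\<Sum>b\<in>Basis. N b)"
        using \<open>z1 \<noteq> z2\<close> by (simp add: divide_le_eq)
    qed
  qed
  then show ?thesis using False by (simp add: divide_le_eq)
qed

lemma lipschitz_const_pos:
  fixes N :: "'a::euclidean_space \<Rightarrow> real"
  assumes N: "is_norm N"
  shows "0 < lipschitz_const N"
proof -
  obtain b :: 'a where b: "b \<in> Basis" using nonempty_Basis by blast
  then have "0 < N b" using is_normD(1,2)[OF N, of b] nonzero_Basis[OF b] by linarith
  then show ?thesis using is_norm_le_lipschitz_const[OF N, of b] b by simp
qed

section \<open>Feasible descent\<close>

text \<open>Separate the origin from {(B x - B x0, t). x in C, t > f x - f x0}: a nonvertical separating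
  functional is a Lagrange multiplier for the equality constraint.\<close>
lemma exists_feasible_decrease:
  fixes B :: "real ^ 'n::finite ^ 'm::finite" and C :: "(real ^ 'n) set"
  assumes C: "closed C" "convex C" "cone C"
    and x\<^sub>0: "x\<^sub>0 \<in> C"
    and f_add: "\<And>x y. f (x + y) \<le> f x + f y"
    and f_scale: "\<And>c x. 0 \<le> c \<Longrightarrow> f (c *\<^sub>R x) = c * f x"
    and f_le: "\<And>x. f x \<le> \<Lambda> * norm x"
    and f_pos: "0 < f x\<^sub>0" and \<Lambda>: "0 < \<Lambda>" and \<beta>: "0 < \<beta>"
    and proj: "\<And>\<mu>. norm \<mu> = 1 \<Longrightarrow> \<beta> \<le> norm (closest_point C (\<mu> v* B))"
    and small: "norm (B *v x\<^sub>0) < f x\<^sub>0 / \<Lambda> * \<beta>"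
  shows "\<exists>x\<in>C. B *v x = B *v x\<^sub>0 \<and> f x < f x\<^sub>0"
proof (rule ccontr)
  assume no: "\<not> ?thesis"
  have "C \<noteq> {}" using x\<^sub>0 by auto
  note orth = closest_point_cone_orthogonal[OF C this] and P_in = closest_point_cone_in[OF C this]
    and P_scale = sublinear_unit.F_scaleR[OF norm_closest_point_cone_sublinear[OF C this]]
  have P_ge: "norm \<mu> * \<beta> \<le> norm (closest_point C (\<mu> v* B))" for \<mu>
  proof (cases "\<mu> = 0")
    case False
    then have "\<beta> \<le> norm (closest_point C ((\<mu> /\<^sub>R norm \<mu>) v* B))" by (intro proj) simp
    also have "(\<mu> /\<^sub>R norm \<mu>) v* B = (\<mu> v* B) /\<^sub>R norm \<mu>"
      by (simp add: vector_matrix_mult_def vec_eq_iff sum_distrib_left mult.assoc)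
    finally show ?thesis using False by (simp add: P_scale field_simps)
  qed simp
  \<comment> \<open>The squared length of the projection p is \<open>h \<bullet> ?p\<close>, so a
    bound on h over C need only be applied at p itself.\<close>
  have P_le: "norm (closest_point C h) \<le> c" if c: "0 \<le> c" "\<And>x. x \<in> C \<Longrightarrow> h \<bullet> x \<le> c * norm x" for h c
  proof -
    let ?p = "closest_point C h"
    have "norm ?p * norm ?p = h \<bullet> ?p"
      using orth[of h] by (simp add: inner_diff power2_norm_eq_inner[symmetric] power2_eq_square)
    also have "\<dots> \<le> c * norm ?p" by (intro c P_in)
    finally show ?thesis using c(1) by (cases "norm ?p = 0") simp_all
  qed
  have scale: "c *\<^sub>R x \<in> C" if "x \<in> C" "0 \<le> c" for c x using that C by (simp add: cone_def)
  let ?S = "{(B *v x - B *v x\<^sub>0, t) | x t. x \<in> C \<and> f x - f x\<^sub>0 < t}"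
  have "convex ?S"
  proof (rule convexI, clarify)
    fix x t y r and u v :: real
    assume xy: "x \<in> C" "f x - f x\<^sub>0 < t" "y \<in> C" "f y - f x\<^sub>0 < r" and uv: "0 \<le> u" "0 \<le> v" "u + v = 1"
    let ?z = "u *\<^sub>R x + v *\<^sub>R y"
    have "?z \<in> C" using C(2) xy uv by (intro convexD)
    moreover have "f ?z - f x\<^sub>0 < u * t + v * r"
    proof -
      have "f ?z - f x\<^sub>0 \<le> u * f x + v * f y - (u + v) * f x\<^sub>0"
        using f_add[of "u *\<^sub>R x" "v *\<^sub>R y"] f_scale uv by simp
      also have "\<dots> = u * (f x - f x\<^sub>0) + v * (f y - f x\<^sub>0)" by (simp add: algebra_simps)
      also have "\<dots> < u * t + v * r"
        using xy uv by (cases "u = 0") (auto intro!: add_less_le_mono mult_left_mono)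
      finally show ?thesis .
    qed
    moreover have "u *\<^sub>R (B *v x - B *v x\<^sub>0) + v *\<^sub>R (B *v y - B *v x\<^sub>0) = B *v ?z - B *v x\<^sub>0"
    proof -
      have "u *\<^sub>R (B *v x - B *v x\<^sub>0) + v *\<^sub>R (B *v y - B *v x\<^sub>0) = u *\<^sub>R (B *v x) + v *\<^sub>R (B *v y) - (u + v) *\<^sub>R (B *v x\<^sub>0)"
        by (simp add: algebra_simps)
      then show ?thesis using uv by (simp add: matrix_vector_right_distrib matrix_vector_mult_scaleR)
    qed
    ultimately show "\<exists>x' t'. u *\<^sub>R (B *v x - B *v x\<^sub>0, t) + v *\<^sub>R (B *v y - B *v x\<^sub>0, r) = (B *v x' - B *v x\<^sub>0, t') \<and> x' \<in> C \<and> f x' - f x\<^sub>0 < t'"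
      by (intro exI[of _ ?z] exI[of _ "u * t + v * r"]) simp
  qed
  moreover have "0 \<notin> ?S" using no by (auto simp: zero_prod_def)
  ultimately obtain a where "a \<noteq> 0" and a: "\<And>p. p \<in> ?S \<Longrightarrow> 0 \<le> a \<bullet> p"
    using separating_hyperplane_set_0[of ?S] by blast
  obtain \<mu> \<nu> where a_eq: "a = (\<mu>, \<nu>)" by (cases a)
  have sep: "0 \<le> \<mu> \<bullet> (B *v x - B *v x\<^sub>0) + \<nu> * t" if "x \<in> C" "f x - f x\<^sub>0 < t" for x t
    using a[of "(B *v x - B *v x\<^sub>0, t)"] that by (auto simp: a_eq)
  have adj: "\<mu> \<bullet> (B *v x) = (\<mu> v* B) \<bullet> x" for x by (simp add: dot_lmul_matrix)
  have "0 \<le> \<nu>" using sep[OF x\<^sub>0, of 1] by simp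
  \<comment> \<open>The sign is chosen so that h ends up dominated by \<open>\<nu> * f\<close> on
    C.\<close>
  define h where "h = - (\<mu> v* B)"
  have h_eq: "h = (- \<mu>) v* B" by (simp add: h_def vector_matrix_mult_def vec_eq_iff sum_negf)
  have lim: "h \<bullet> x - h \<bullet> x\<^sub>0 \<le> \<nu> * (f x - f x\<^sub>0)" if "x \<in> C" for x
  proof (rule field_le_epsilon)
    fix e :: real assume "e > 0"
    \<comment> \<open>The summand 1 keeps the divisor positive, since \<open>\<nu> = 0\<close> is
      excluded only later.\<close>
    define d where "d = e / (\<nu> + 1)"
    have "d > 0" "\<nu> * d \<le> e" using \<open>e > 0\<close> \<open>0 \<le> \<nu>\<close> by (auto simp: d_def field_simps)
    with sep[OF that, of "f x - f x\<^sub>0 + d"]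
    show "h \<bullet> x - h \<bullet> x\<^sub>0 \<le> \<nu> * (f x - f x\<^sub>0) + e"
      by (simp add: h_def inner_diff_right adj algebra_simps)
  qed
  \<comment> \<open>Testing at the multiples 0 and 2 of \<open>x\<^sub>0\<close> gives the two
    inequalities by homogeneity.\<close>
  have h_x\<^sub>0: "h \<bullet> x\<^sub>0 = \<nu> * f x\<^sub>0"
    using lim[OF scale[OF x\<^sub>0, of 0]] lim[OF scale[OF x\<^sub>0, of 2]] f_scale[of 0 x\<^sub>0] f_scale[of 2 x\<^sub>0] by simp
  have h_le: "h \<bullet> x \<le> \<nu> * f x" if "x \<in> C" for x
    using lim[OF that] h_x\<^sub>0 by (simp add: algebra_simps)
  have "norm (closest_point C h) \<le> \<nu> * \<Lambda>"
  proof (rule P_le)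
    show "0 \<le> \<nu> * \<Lambda>" using \<open>0 \<le> \<nu>\<close> \<Lambda> by simp
    show "h \<bullet> x \<le> \<nu> * \<Lambda> * norm x" if "x \<in> C" for x
      using h_le[OF that] mult_left_mono[OF f_le[of x] \<open>0 \<le> \<nu>\<close>] by simp
  qed
  then have \<mu>_le: "norm \<mu> * \<beta> \<le> \<nu> * \<Lambda>"
    using P_ge[of "- \<mu>"] by (simp add: h_eq)
  \<comment> \<open>The hyperplane is nonvertical: \<open>\<nu> = 0\<close> would make the
    projection of h vanish, and the positive lower bound \<open>\<beta>\<close> would then force
    \<open>\<mu> = 0\<close>.\<close>
  have "\<nu> \<noteq> 0"
  proof
    assume "\<nu> = 0"
    then have "\<mu> = 0" using \<mu>_le \<beta> by (simp add: mult_le_0_iff)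
    with \<open>\<nu> = 0\<close> \<open>a \<noteq> 0\<close> show False by (simp add: a_eq zero_prod_def)
  qed
  with \<open>0 \<le> \<nu>\<close> have \<nu>: "0 < \<nu>" by simp
  have "\<nu> * f x\<^sub>0 = (- \<mu>) \<bullet> (B *v x\<^sub>0)" by (simp add: h_x\<^sub>0[symmetric] h_def adj)
  also have "\<dots> \<le> norm \<mu> * norm (B *v x\<^sub>0)" using norm_cauchy_schwarz[of "- \<mu>" "B *v x\<^sub>0"] by simp
  also have "\<dots> \<le> (\<nu> * \<Lambda> / \<beta>) * norm (B *v x\<^sub>0)"
    using \<mu>_le \<beta> by (intro mult_right_mono) (simp_all add: field_simps)
  also have "\<dots> < (\<nu> * \<Lambda> / \<beta>) * (f x\<^sub>0 / \<Lambda> * \<beta>)"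
    using small \<nu> \<Lambda> \<beta> by (intro mult_strict_left_mono) auto
  also have "\<dots> = \<nu> * f x\<^sub>0" using \<Lambda> \<beta> by simp
  finally show False by simp
qed

text \<open>The existential ranges over uncountably many x. After C is cut to a ball and the strict
  inequality is replaced by a gap 1/(k+1), the event is the projection of a closed set along a
  compact factor, hence closed; the union over k is countable.\<close>

lemma sets_feasible_decrease:
  fixes C :: "(real ^ 'n::finite) set" and f :: "real ^ 'n \<Rightarrow> real"
  assumes C: "closed C" and f: "continuous_on UNIV f"
  shows "{B :: real ^ 'n ^ 'm::finite. \<exists>x\<in>C. B *v x = B *v x\<^sub>0 \<and> f x < f x\<^sub>0} \<in> sets borel"
proof -
  let ?D = "\<lambda>k. {B :: real ^ 'n ^ 'm. \<exists>x. x \<in> C \<inter> cball 0 (real k) \<and>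
     (x, B) \<in> {p. f (fst p) \<le> f x\<^sub>0 - 1 / real (Suc k) \<and> snd p *v fst p = snd p *v x\<^sub>0}}"
  have "closed (?D k)" for k
  proof (rule closed_compact_projection)
    show "compact (C \<inter> cball 0 (real k))" using C by (intro closed_Int_compact) auto
    have "continuous_on UNIV (\<lambda>p :: (real ^ 'n) \<times> (real ^ 'n ^ 'm). f (fst p))"
      by (rule continuous_on_compose2[OF f]) (auto intro: continuous_intros)
    moreover have "continuous_on UNIV (\<lambda>p :: (real ^ 'n) \<times> (real ^ 'n ^ 'm). snd p *v fst p)"
      "continuous_on UNIV (\<lambda>p :: (real ^ 'n) \<times> (real ^ 'n ^ 'm). snd p *v x\<^sub>0)"
      unfolding matrix_vector_mult_def by (auto intro!: continuous_intros)
    ultimately show "closed {p :: (real ^ 'n) \<times> (real ^ 'n ^ 'm). f (fst p) \<le> f x\<^sub>0 - 1 / real (Suc k) \<and> snd p *v fst p = snd p *v x\<^sub>0}"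
      by (intro closed_Collect_conj closed_Collect_le closed_Collect_eq continuous_intros)
  qed
  then have "(\<Union>k. ?D k) \<in> sets borel" by (intro sets.countable_UN) auto
  also have "(\<Union>k. ?D k) = {B :: real ^ 'n ^ 'm. \<exists>x\<in>C. B *v x = B *v x\<^sub>0 \<and> f x < f x\<^sub>0}"
  proof (intro set_eqI iffI)
    fix B :: "real ^ 'n ^ 'm" assume "B \<in> (\<Union>k. ?D k)"
    then obtain k x where "x \<in> C" "f x \<le> f x\<^sub>0 - 1 / real (Suc k)" "B *v x = B *v x\<^sub>0" by auto
    moreover have "0 < 1 / real (Suc k)" by simp
    ultimately have "f x < f x\<^sub>0" by linarith
    with \<open>x \<in> C\<close> \<open>B *v x = B *v x\<^sub>0\<close> show "B \<in> {B. \<exists>x\<in>C. B *v x = B *v x\<^sub>0 \<and> f x < f x\<^sub>0}" by blast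
  next
    fix B :: "real ^ 'n ^ 'm" assume "B \<in> {B. \<exists>x\<in>C. B *v x = B *v x\<^sub>0 \<and> f x < f x\<^sub>0}"
    then obtain x where x: "x \<in> C" "B *v x = B *v x\<^sub>0" "f x < f x\<^sub>0" by auto
    obtain k1 :: nat where k1: "norm x \<le> real k1" using real_arch_simple by blast
    obtain k2 :: nat where k2: "inverse (real (Suc k2)) < f x\<^sub>0 - f x"
      using reals_Archimedean[of "f x\<^sub>0 - f x"] x by auto
    have "1 / real (Suc (max k1 k2)) \<le> inverse (real (Suc k2))" by (simp add: field_simps)
    then have "B \<in> ?D (max k1 k2)" using x k1 k2 by auto
    then show "B \<in> (\<Union>k. ?D k)" by blast
  qed
  finally show ?thesis .
qed

section \<open>Numerical and probabilistic estimates\<close>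

lemma exp_lower_bounds: "2 \<le> exp (1 :: real)" "9 \<le> exp (23 / 10 :: real)"
proof -
  show "2 \<le> exp (1 :: real)" using exp_ge_add_one_self[of 1] by simp
  \<comment> \<open>9 is the base of the net size. The exponent is split into four parts 23/40, for
    which the quadratic Taylor polynomial is sharp enough.\<close>
  have "(9::real) \<le> (1 + 23 / 40 + (23 / 40)\<^sup>2 / 2) ^ 4" by (simp add: eval_nat_numeral)
  also have "\<dots> \<le> exp (23 / 40) ^ 4" by (intro power_mono exp_lower_Taylor_quadratic) auto
  also have "\<dots> = exp (23 / 10 :: real)" by (simp add: exp_of_nat_mult[symmetric])
  finally show "9 \<le> exp (23 / 10 :: real)" .
qed

text \<open>Chernoff's bound with exp(|x|^2 / 4), whose expectation is sqrt 2 to the power of the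
  dimension.\<close>

lemma measure_std_gauss_norm_ge:
  assumes "0 \<le> r"
  shows "measure (std_gauss :: 'a::euclidean_space measure) {x. r \<le> norm x} \<le> exp (- r\<^sup>2 / 4) * sqrt 2 ^ DIM('a)"
proof -
  let ?f = "\<lambda>x::'a. exp (1 / 4 * (norm x)\<^sup>2)"
  have nn: "(\<integral>\<^sup>+x. ennreal (?f x) \<partial>std_gauss) = ennreal (sqrt 2 ^ DIM('a))"
    using nn_integral_std_gauss_exp_norm[of "1 / 2", where 'a='a] by (simp add: real_sqrt_divide)
  have int: "integrable std_gauss ?f"
    by (rule integrableI_bounded) (simp_all add: nn[simplified])
  have "measure std_gauss {x \<in> space (std_gauss :: 'a measure). r\<^sup>2 \<le> (norm x)\<^sup>2} \<le>
      exp (- (1 / 4) * r\<^sup>2) * (\<integral>x\<in>space (std_gauss :: 'a measure). ?f x \<partial>std_gauss)"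
    using int by (intro std_gauss.Chernoff_ineq_ge) (auto simp: set_integrable_def)
  also have "(\<integral>x\<in>space (std_gauss :: 'a measure). ?f x \<partial>std_gauss) = sqrt 2 ^ DIM('a)"
    unfolding set_lebesgue_integral_def by (subst integral_eq_nn_integral) (simp_all add: nn[simplified])
  also have "{x \<in> space (std_gauss :: 'a measure). r\<^sup>2 \<le> (norm x)\<^sup>2} = {x. r \<le> norm x}"
    using assms by (auto simp: abs_le_square_iff[symmetric])
  finally show ?thesis by simp
qed

lemma gaussian_dist_eq: "gaussian_dist S = (\<integral>x. infdist x S \<partial>std_gauss)"
proof -
  have "(\<integral>x. infdist x S \<partial>std_gauss) = (\<integral>g. infdist (\<chi> i. g i) S \<partial>(\<Pi>\<^sub>M i\<in>UNIV. density lborel std_normal_density))"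
    unfolding std_gauss_eq_distr_PiM[symmetric]
    by (rule integral_distr[OF measurable_vec_lambda_PiM])
       (intro borel_measurable_continuous_onI continuous_intros)
  then show ?thesis by (simp add: gaussian_dist_def)
qed

text \<open>The expectation of Pythagoras; each of the two second moments exceeds the squared mean
  by at most 6.\<close>

lemma DIM_le_mean_closest_point_cone:
  fixes C :: "'a::euclidean_space set"
  assumes C: "closed C" "convex C" "cone C" "C \<noteq> {}"
  shows "real DIM('a) \<le> (\<integral>h. norm (closest_point C h) \<partial>std_gauss)\<^sup>2 + (\<integral>h. infdist h C \<partial>std_gauss)\<^sup>2 + 12"
proof -
  interpret P: sublinear_unit "\<lambda>h. norm (closest_point C h)" "\<lambda>h. closest_point C h /\<^sub>R norm (closest_point C h)"
    by (rule norm_closest_point_cone_sublinear[OF C])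
  interpret Q: sublinear_unit "\<lambda>h. norm (h - closest_point C h)" "\<lambda>h. (h - closest_point C h) /\<^sub>R norm (h - closest_point C h)"
    by (rule dist_closest_point_cone_sublinear[OF C])
  have "real DIM('a) = (\<integral>h. (norm h)\<^sup>2 \<partial>(std_gauss :: 'a measure))"
    by (simp add: integral_std_gauss_norm_square)
  also have "\<dots> = (\<integral>h. (norm (closest_point C h))\<^sup>2 + (norm (h - closest_point C h))\<^sup>2 \<partial>std_gauss)"
    by (simp add: norm_closest_point_cone_pythagoras[OF C, symmetric])
  also have "\<dots> = (\<integral>h. (norm (closest_point C h))\<^sup>2 \<partial>std_gauss) + (\<integral>h. (norm (h - closest_point C h))\<^sup>2 \<partial>std_gauss)"
    by (intro Bochner_Integration.integral_add P.integrable_F_square Q.integrable_F_square)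
  also have "\<dots> \<le> (P.mean\<^sup>2 + 6) + (Q.mean\<^sup>2 + 6)"
    by (intro add_mono P.second_moment_le Q.second_moment_le)
  finally show ?thesis by (simp add: infdist_closest_point[OF C])
qed

lemma measurable_std_gaussian_matrix:
  fixes A :: "'w \<Rightarrow> real ^ 'n::finite ^ 'm::finite"
  assumes "std_gaussian_matrix M A"
  shows "A \<in> borel_measurable M"
proof (rule borel_measurable_euclidean_space[THEN iffD2], rule ballI)
  fix b :: "real ^ 'n ^ 'm" assume "b \<in> Basis"
  then obtain i j where b: "b = axis i (axis j 1)" by (auto simp: Basis_vec_def)
  have "distributed M lborel (\<lambda>\<omega>. A \<omega> $ i $ j) std_normal_density"
    using assms by (simp add: std_gaussian_matrix_def)
  from distributed_measurable[OF this] show "(\<lambda>\<omega>. A \<omega> \<bullet> b) \<in> borel_measurable M"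
    by (simp add: b inner_axis)
qed

text \<open>Here \<open>R\<close> bounds the squared mean projection length from below up to the
  constant 12. Outside the events \<open>?lo\<close>, \<open>?hi\<close> and \<open>?ax\<close> the
  deterministic criterion applies with \<beta> = 0.15 sqrt R. The events over the whole net cost 2
  exp(-q/16), and \<open>?ax\<close> costs one more such term.\<close>

lemma prob_feasible_decrease:
  fixes A :: "'w \<Rightarrow> real ^ 'n::finite ^ 'm::finite" and C :: "(real ^ 'n) set"
  assumes M: "prob_space M" and A: "std_gaussian_matrix M A"
    and C: "closed C" "convex C" "cone C"
    and x\<^sub>0: "x\<^sub>0 \<in> C" "norm x\<^sub>0 = 1"
    and f_add: "\<And>x y. f (x + y) \<le> f x + f y"
    and f_scale: "\<And>c x. 0 \<le> c \<Longrightarrow> f (c *\<^sub>R x) = c * f x"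
    and f_le: "\<And>x. f x \<le> \<Lambda> * norm x"
    and f_cont: "continuous_on UNIV f"
    and f_pos: "0 < f x\<^sub>0" and \<Lambda>: "0 < \<Lambda>"
    and q: "real CARD('m) \<le> q" "q = R * (f x\<^sub>0 / \<Lambda>)\<^sup>2 / 100"
    and R: "R + (\<integral>h. infdist h C \<partial>std_gauss)\<^sup>2 \<le> real CARD('n)"
  shows "measure M {\<omega> \<in> space M. \<exists>x\<in>C. A \<omega> *v x = A \<omega> *v x\<^sub>0 \<and> f x < f x\<^sub>0} \<ge> 1 - 3 * exp (- q / 16)"
proof -
  interpret prob_space M by fact
  have "C \<noteq> {}" using x\<^sub>0 by auto
  note C' = C this
  interpret P: sublinear_unit "\<lambda>h. norm (closest_point C h)" "\<lambda>h. closest_point C h /\<^sub>R norm (closest_point C h)"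
    by (rule norm_closest_point_cone_sublinear[OF C'])
  have A_meas[measurable]: "A \<in> borel_measurable M" by (rule measurable_std_gaussian_matrix[OF A])
  define \<kappa> where "\<kappa> = f x\<^sub>0 / \<Lambda>"
  have \<kappa>: "0 < \<kappa>" "\<kappa> \<le> 1" using f_pos f_le[of x\<^sub>0] x\<^sub>0 \<Lambda> by (simp_all add: \<kappa>_def)
  have \<kappa>2: "\<kappa>\<^sup>2 \<le> 1" "0 < \<kappa>\<^sup>2" using \<kappa> by (simp_all add: power_le_one)
  have q1: "1 \<le> q" using q(1) by (rule order_trans[rotated]) simp
  have qR: "100 * q = R * \<kappa>\<^sup>2" using q(2) by (simp add: \<kappa>_def)
  then have "0 < R * \<kappa>\<^sup>2" using q1 by simp
  then have "0 < R" using \<kappa>2 by (simp add: zero_less_mult_iff)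
  then have "R * \<kappa>\<^sup>2 \<le> R * 1" using \<kappa>2 by (intro mult_left_mono) auto
  then have R_ge: "100 * q \<le> R" by (simp add: qR)
  define r where "r = sqrt R"
  have r: "0 < r" "r\<^sup>2 = R" using \<open>0 < R\<close> by (simp_all add: r_def)
  define e where "e = P.mean"
  \<comment> \<open>Large enough that t^2/5 = 0.0245 R >= 2.45 q beats the net exponent 2.3 q by
    more than q/16, and small enough that the net argument still leaves (e - t) - (e + t)/3 >= 0.15
    r when e >= 0.93 r.\<close>
  define t where "t = 35 / 100 * r"
  have t: "0 < t" using r by (simp add: t_def)
  \<comment> \<open>Since R >= 100, the constant 12 is at most 0.12 R, and 0.93^2 = 0.8649 <=
    0.88.\<close>
  have e: "93 / 100 * r \<le> e"
  proof (rule power2_le_imp_le)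
    have "(93 / 100 * r)\<^sup>2 = 8649 / 10000 * R" using r by (simp add: power_mult_distrib power_divide)
    also have "\<dots> \<le> R - 12" using R_ge q1 by simp
    also have "\<dots> \<le> e\<^sup>2" using DIM_le_mean_closest_point_cone[OF C'] R by (simp add: e_def)
    finally show "(93 / 100 * r)\<^sup>2 \<le> e\<^sup>2" .
    show "0 \<le> e" unfolding e_def by simp
  qed
  obtain T :: "(real ^ 'm) set" where T: "finite T" "T \<subseteq> sphere 0 1" "card T \<le> 9 ^ CARD('m)"
    and net: "\<And>x. norm x = 1 \<Longrightarrow> \<exists>y\<in>T. norm (x - y) \<le> 1 / 4"
    using sphere_net[where 'a="real ^ 'm"] by auto
  let ?g = "\<lambda>\<mu> B. norm (closest_point C (\<mu> v* B))"
  let ?lo = "\<lambda>\<mu>. {\<omega> \<in> space M. ?g \<mu> (A \<omega>) \<le> e - t}" and ?hi = "\<lambda>\<mu>. {\<omega> \<in> space M. e + t \<le> ?g \<mu> (A \<omega>)}"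
  let ?ax = "{\<omega> \<in> space M. \<kappa> * (15 / 100 * r) \<le> norm (A \<omega> *v x\<^sub>0)}"
  let ?good = "{\<omega> \<in> space M. \<exists>x\<in>C. A \<omega> *v x = A \<omega> *v x\<^sub>0 \<and> f x < f x\<^sub>0}"
  have "continuous_on UNIV (\<lambda>B :: real ^ 'n ^ 'm. \<mu> v* B)" for \<mu>
    unfolding vector_matrix_mult_def by (auto intro!: continuous_intros)
  from measurable_compose[OF A_meas borel_measurable_continuous_onI[OF this]]
  have vmA[measurable]: "(\<lambda>\<omega>. \<mu> v* A \<omega>) \<in> borel_measurable M" for \<mu> .
  have "continuous_on UNIV (\<lambda>B :: real ^ 'n ^ 'm. B *v x)" for x
    unfolding matrix_vector_mult_def by (auto intro!: continuous_intros)
  from measurable_compose[OF A_meas borel_measurable_continuous_onI[OF this]]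
  have mvA[measurable]: "(\<lambda>\<omega>. A \<omega> *v x) \<in> borel_measurable M" for x .
  have events: "?lo \<mu> \<in> events" "?hi \<mu> \<in> events" "?ax \<in> events" for \<mu>
    using measurable_closest_point_cone[OF C'] by measurable
  have good: "?good \<in> events"
    using measurable_sets[OF A_meas sets_feasible_decrease[OF C(1) f_cont, of x\<^sub>0]]
    by (simp add: vimage_def Int_def conj_commute)
  have tail: "prob {\<omega> \<in> space M. Z \<omega> \<in> U} = measure std_gauss U"
    if "Z \<in> borel_measurable M" "distr M borel Z = std_gauss" "U \<in> sets borel" for Z :: "'w \<Rightarrow> 'z::euclidean_space" and U
    using measure_distr[OF that(1,3)] that(2) by (simp add: vimage_def Int_def conj_commute)
  have lohi: "prob (?lo \<mu>) \<le> exp (- t\<^sup>2 / 5)" "prob (?hi \<mu>) \<le> exp (- t\<^sup>2 / 5)" if "\<mu> \<in> T" for \<mu>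
  proof -
    have d: "distr M borel (\<lambda>\<omega>. \<mu> v* A \<omega>) = std_gauss"
      using that T by (intro distr_vector_matrix_mult[OF M A]) auto
    have "{h. norm (closest_point C h) \<le> e - t} \<in> sets borel" "{h. e + t \<le> norm (closest_point C h)} \<in> sets borel"
      using measurable_closest_point_cone[OF C'] by measurable
    from this[THEN tail[OF vmA d]] P.lower_tail[OF t] P.upper_tail[OF t]
    show "prob (?lo \<mu>) \<le> exp (- t\<^sup>2 / 5)" "prob (?hi \<mu>) \<le> exp (- t\<^sup>2 / 5)" by (simp_all add: e_def)
  qed
  have ax: "prob ?ax \<le> exp (- q / 16)"
  proof -
    have "{z :: real ^ 'm. \<kappa> * (15 / 100 * r) \<le> norm z} \<in> sets borel" by measurable
    from tail[OF mvA distr_matrix_vector_mult[OF M A x\<^sub>0(2)] this]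
    have "prob ?ax = measure (std_gauss :: (real ^ 'm) measure) {z. \<kappa> * (15 / 100 * r) \<le> norm z}" by simp
    also have "\<dots> \<le> exp (- (\<kappa> * (15 / 100 * r))\<^sup>2 / 4) * sqrt 2 ^ CARD('m)"
      using measure_std_gauss_norm_ge[of "\<kappa> * (15 / 100 * r)", where 'a="real ^ 'm"] \<kappa> r by simp
    also have "(\<kappa> * (15 / 100 * r))\<^sup>2 = 225 / 100 * q"
      using qR r by (simp add: power_mult_distrib power_divide mult.commute)
    also have "sqrt 2 ^ CARD('m) \<le> exp (1 / 2 :: real) ^ CARD('m)"
    proof (intro power_mono real_le_lsqrt)
      have "exp (1 / 2) ^ 2 = exp (1 :: real)" by (simp add: exp_of_nat_mult[symmetric])
      then show "2 \<le> (exp (1 / 2 :: real))\<^sup>2" using exp_lower_bounds(1) by simp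
    qed auto
    also have "exp (1 / 2) ^ CARD('m) = exp (real CARD('m) / 2)" by (simp add: exp_of_nat_mult[symmetric])
    \<comment> \<open>The squared threshold 2.25 q contributes 9/16 q and the dimension at most q/2;
      the difference is exactly q/16.\<close>
    also have "exp (- (225 / 100 * q) / 4) * exp (real CARD('m) / 2) \<le> exp (- q / 16)"
      unfolding exp_add[symmetric] exp_le_cancel_iff using q(1) by simp
    finally show ?thesis by simp
  qed
  have sub: "space M - ((\<Union>\<mu>\<in>T. ?lo \<mu> \<union> ?hi \<mu>) \<union> ?ax) \<subseteq> ?good"
  proof
    fix \<omega> assume \<omega>: "\<omega> \<in> space M - ((\<Union>\<mu>\<in>T. ?lo \<mu> \<union> ?hi \<mu>) \<union> ?ax)"
    have "\<exists>x\<in>C. A \<omega> *v x = A \<omega> *v x\<^sub>0 \<and> f x < f x\<^sub>0"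
    proof (rule exists_feasible_decrease[OF C x\<^sub>0(1) f_add f_scale f_le f_pos \<Lambda>])
      show "0 < 15 / 100 * r" using r by simp
      show "norm (A \<omega> *v x\<^sub>0) < f x\<^sub>0 / \<Lambda> * (15 / 100 * r)"
        using \<omega> by (auto simp: \<kappa>_def not_le)
      fix \<mu> :: "real ^ 'm" assume \<mu>: "norm \<mu> = 1"
      have "(e - t) - (e + t) / 3 = 2 / 3 * e - 7 / 15 * r" by (simp add: t_def field_simps)
      moreover have "15 / 100 * r \<le> 2 / 3 * (93 / 100 * r) - 7 / 15 * r" using r(1) by simp
      moreover have "2 / 3 * (93 / 100 * r) \<le> 2 / 3 * e" by (intro mult_left_mono e) simp
      ultimately have "15 / 100 * r \<le> (e - t) - (e + t) / 3" by simp
      also have "\<dots> \<le> ?g \<mu> (A \<omega>)"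
      proof (rule sublinear_ge_on_sphere[where g="\<lambda>\<mu>. ?g \<mu> (A \<omega>)", OF _ _ _ _ net _ _ \<mu>])
        show "0 \<le> ?g x (A \<omega>)" for x by simp
        show "?g (x + y) (A \<omega>) \<le> ?g x (A \<omega>) + ?g y (A \<omega>)" for x y
          using P.F_add_le[of "x v* A \<omega>" "y v* A \<omega>"] by (simp add: vector_matrix_left_distrib)
        show "?g (c *\<^sub>R x) (A \<omega>) = c * ?g x (A \<omega>)" if "0 \<le> c" for c x
          using P.F_scaleR[OF that, of "x v* A \<omega>"] by (simp add: scaleR_vector_matrix_assoc)
        have "continuous_on UNIV (\<lambda>\<mu>. \<mu> v* A \<omega>)"
          unfolding vector_matrix_mult_def by (auto intro!: continuous_intros)
        then show "continuous_on UNIV (\<lambda>\<mu>. ?g \<mu> (A \<omega>))"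
          using continuous_on_compose2[OF continuous_on_closest_point[OF C(2,1) \<open>C \<noteq> {}\<close>, of UNIV]]
          by (intro continuous_on_norm) auto
        show "e - t \<le> ?g y (A \<omega>)" "?g y (A \<omega>) \<le> e + t" if "y \<in> T" for y
          using \<omega> that by (auto simp: not_le intro: less_imp_le)
      qed
      finally show "15 / 100 * r \<le> ?g \<mu> (A \<omega>)" .
    qed
    with \<omega> show "\<omega> \<in> ?good" by simp
  qed
  have "prob ((\<Union>\<mu>\<in>T. ?lo \<mu> \<union> ?hi \<mu>) \<union> ?ax) \<le> prob (\<Union>\<mu>\<in>T. ?lo \<mu> \<union> ?hi \<mu>) + prob ?ax"
    using T events by (intro measure_Un_le sets.Un sets.finite_UN)
  also have "prob (\<Union>\<mu>\<in>T. ?lo \<mu> \<union> ?hi \<mu>) \<le> (\<Sum>\<mu>\<in>T. prob (?lo \<mu> \<union> ?hi \<mu>))"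
    using T events by (intro measure_UNION_le sets.Un)
  also have "\<dots> \<le> (\<Sum>\<mu>\<in>T. 2 * exp (- t\<^sup>2 / 5))"
  proof (rule sum_mono)
    fix \<mu> assume "\<mu> \<in> T"
    have "prob (?lo \<mu> \<union> ?hi \<mu>) \<le> prob (?lo \<mu>) + prob (?hi \<mu>)" by (intro measure_Un_le events)
    then show "prob (?lo \<mu> \<union> ?hi \<mu>) \<le> 2 * exp (- t\<^sup>2 / 5)" using lohi[OF \<open>\<mu> \<in> T\<close>] by simp
  qed
  also have "\<dots> = real (card T) * (2 * exp (- t\<^sup>2 / 5))" by simp
  also have "\<dots> \<le> exp (23 / 10 * q) * (2 * exp (- t\<^sup>2 / 5))"
  proof (rule mult_right_mono)
    have "real (card T) \<le> 9 ^ CARD('m)" using T(3) by (metis of_nat_le_iff of_nat_numeral of_nat_power)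
    also have "\<dots> \<le> exp (23 / 10) ^ CARD('m)" using exp_lower_bounds(2) by (intro power_mono) auto
    also have "\<dots> = exp (23 / 10 * real CARD('m))" by (simp add: exp_of_nat_mult[symmetric] mult.commute)
    also have "\<dots> \<le> exp (23 / 10 * q)" using q(1) by simp
    finally show "real (card T) \<le> exp (23 / 10 * q)" .
  qed simp
  also have "\<dots> = 2 * exp (23 / 10 * q - t\<^sup>2 / 5)" using exp_add[of "23 / 10 * q" "- t\<^sup>2 / 5"] by simp
  also have "\<dots> \<le> 2 * exp (- q / 16)"
  proof -
    have "t\<^sup>2 / 5 = 245 / 10000 * R" using r by (simp add: t_def power_mult_distrib power_divide)
    then have "23 / 10 * q - t\<^sup>2 / 5 \<le> - q / 16" using R_ge q1 by simp
    then show ?thesis by simp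
  qed
  finally have "prob ((\<Union>\<mu>\<in>T. ?lo \<mu> \<union> ?hi \<mu>) \<union> ?ax) \<le> 3 * exp (- q / 16)" using ax by simp
  moreover have "prob (space M - ((\<Union>\<mu>\<in>T. ?lo \<mu> \<union> ?hi \<mu>) \<union> ?ax)) = 1 - prob ((\<Union>\<mu>\<in>T. ?lo \<mu> \<union> ?hi \<mu>) \<union> ?ax)"
    using T events by (intro prob_compl sets.Un sets.finite_UN)
  moreover have "prob (space M - ((\<Union>\<mu>\<in>T. ?lo \<mu> \<union> ?hi \<mu>) \<union> ?ax)) \<le> prob ?good"
    using sub good by (rule finite_measure_mono)
  ultimately show ?thesis by simp
qed

theorem corollary3p1:
  fixes M :: "'w measure"
    and A :: "'w \<Rightarrow> real ^ 'n::finite ^ 'm::finite"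
    and C :: "(real ^ 'n) set"
    and x\<^sub>0 xbar\<^sub>0 :: "real ^ 'n"
    and \<tau> :: nat
    and N :: "nat \<Rightarrow> real ^ 'n \<Rightarrow> real"
    and L \<kappa> lam lambar :: "nat \<Rightarrow> real"
    and f :: "real ^ 'n \<Rightarrow> real"
    and m_low :: real
  defines "xbar\<^sub>0 \<equiv> x\<^sub>0 /\<^sub>R norm x\<^sub>0"
    and "L \<equiv> \<lambda>i. lipschitz_const (N i)"
    and "\<kappa> \<equiv> \<lambda>i. N i xbar\<^sub>0 / L i"
    and "f \<equiv> \<lambda>x. \<Sum>i=1..\<tau>. lam i * N i x"
    and "lambar \<equiv> \<lambda>i. lam i * L i / (\<Sum>j=1..\<tau>. lam j * L j)"
    and "m_low \<equiv> real CARD('n) * (1 - normalized_gaussian_dist C)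
                   * (\<Sum>i=1..\<tau>. lambar i * \<kappa> i)\<^sup>2 / 100"
  assumes "closed C" and "convex C" and "cone C"
    and "x\<^sub>0 \<in> C" and "x\<^sub>0 \<noteq> 0"
    and "\<And>i. i \<in> {1..\<tau>} \<Longrightarrow> is_norm (N i)"
    and "\<And>i. i \<in> {1..\<tau>} \<Longrightarrow> lam i \<ge> 0"
    and "\<exists>i\<in>{1..\<tau>}. lam i \<noteq> 0"
    and "prob_space M" and "std_gaussian_matrix M A"
    and "real CARD('m) \<le> m_low"
  shows "measure M {\<omega> \<in> space M.
             \<not> is_arg_min f (\<lambda>x. x \<in> C \<and> A \<omega> *v x = A \<omega> *v x\<^sub>0) x\<^sub>0}
         \<ge> 1 - 10 * exp (- (1 / 16) *
             min m_low ((1 - normalized_gaussian_dist C)\<^sup>2 * real CARD('n)))"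
proof -
  note C = \<open>closed C\<close> \<open>convex C\<close> \<open>cone C\<close>
  note N = \<open>\<And>i. i \<in> {1..\<tau>} \<Longrightarrow> is_norm (N i)\<close> and lam = \<open>\<And>i. i \<in> {1..\<tau>} \<Longrightarrow> lam i \<ge> 0\<close>
  obtain k where k: "k \<in> {1..\<tau>}" "0 < lam k" using \<open>\<exists>i\<in>{1..\<tau>}. lam i \<noteq> 0\<close> lam by force
  define \<Lambda> where "\<Lambda> = (\<Sum>j=1..\<tau>. lam j * L j)"
  have L: "0 < L i" if "i \<in> {1..\<tau>}" for i unfolding L_def using N[OF that] by (rule lipschitz_const_pos)
  have \<Lambda>: "0 < \<Lambda>" unfolding \<Lambda>_def
    using k L lam by (intro sum_pos2[OF _ k(1)] mult_pos_pos mult_nonneg_nonneg) (auto intro: less_imp_le)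
  have f_add: "f (x + y) \<le> f x + f y" for x y
    unfolding f_def sum.distrib[symmetric] distrib_left[symmetric]
    by (intro sum_mono mult_left_mono is_normD(4) N lam)
  have f_scale: "f (c *\<^sub>R x) = c * f x" if "0 \<le> c" for c x
    unfolding f_def sum_distrib_left using that by (intro sum.cong) (simp_all add: is_normD(3)[OF N])
  have f_le: "f x \<le> \<Lambda> * norm x" for x
    unfolding f_def \<Lambda>_def sum_distrib_right mult.assoc L_def
    by (intro sum_mono mult_left_mono is_norm_le_lipschitz_const N lam)
  have f_cont: "continuous_on UNIV f"
    unfolding f_def by (intro continuous_intros continuous_on_is_norm N)
  have xbar: "xbar\<^sub>0 \<in> C" "norm xbar\<^sub>0 = 1" "xbar\<^sub>0 \<noteq> 0" and x\<^sub>0: "x\<^sub>0 = norm x\<^sub>0 *\<^sub>R xbar\<^sub>0"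
    using \<open>x\<^sub>0 \<in> C\<close> \<open>x\<^sub>0 \<noteq> 0\<close> \<open>cone C\<close> by (auto simp: xbar\<^sub>0_def cone_def)
  have f_pos: "0 < f xbar\<^sub>0"
    unfolding f_def
  proof (rule sum_pos2[OF _ k(1)])
    have "0 < N k xbar\<^sub>0" using is_normD(1,2)[OF N[OF k(1)], of xbar\<^sub>0] xbar(3) by linarith
    then show "0 < lam k * N k xbar\<^sub>0" using k by simp
    show "0 \<le> lam i * N i xbar\<^sub>0" if "i \<in> {1..\<tau>}" for i
      using lam[OF that] is_normD(1)[OF N[OF that]] by simp
  qed simp
  have "(\<Sum>i=1..\<tau>. lambar i * \<kappa> i) = (\<Sum>i=1..\<tau>. lam i * N i xbar\<^sub>0 / \<Lambda>)"
    unfolding lambar_def \<kappa>_def \<Lambda>_def[symmetric] by (intro sum.cong refl) (use L in force)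
  also have "\<dots> = f xbar\<^sub>0 / \<Lambda>" by (simp add: f_def sum_divide_distrib)
  finally have \<kappa>: "(\<Sum>i=1..\<tau>. lambar i * \<kappa> i) = f xbar\<^sub>0 / \<Lambda>" .
  let ?D = "normalized_gaussian_dist C"
  define R where "R = real CARD('n) * (1 - ?D)"
  have m_low: "m_low = R * (f xbar\<^sub>0 / \<Lambda>)\<^sup>2 / 100" unfolding m_low_def R_def \<kappa> ..
  \<comment> \<open>There is at least one row, so \<open>m_low\<close> is positive; this is what
    yields \<open>0 < R\<close> and \<open>?D < 1\<close>.\<close>
  have m_low1: "1 \<le> m_low" using \<open>real CARD('m) \<le> m_low\<close> by (rule order_trans[rotated]) simp
  then have "0 < R * (f xbar\<^sub>0 / \<Lambda>)\<^sup>2" by (simp add: m_low)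
  then have "0 < R" by (rule zero_less_mult_pos2) (use \<Lambda> f_pos in simp)
  then have "?D < 1" by (simp add: R_def zero_less_mult_iff)
  have D0: "0 \<le> ?D" unfolding normalized_gaussian_dist_def gaussian_dist_def
    by (intro divide_nonneg_nonneg Bochner_Integration.integral_nonneg infdist_nonneg) auto
  \<comment> \<open>The squared mean distance is n D^2, and D^2 <= D on [0, 1].\<close>
  have "R + (\<integral>h. infdist h C \<partial>std_gauss)\<^sup>2 = real CARD('n) * (1 - ?D + ?D\<^sup>2)"
    by (simp add: R_def gaussian_dist_eq[symmetric] normalized_gaussian_dist_def power_divide algebra_simps)
  also have "\<dots> \<le> real CARD('n) * 1"
    using D0 \<open>?D < 1\<close> by (intro mult_left_mono) (auto simp: power2_eq_square mult_left_le)
  finally have R: "R + (\<integral>h. infdist h C \<partial>std_gauss)\<^sup>2 \<le> real CARD('n)" by simp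
  let ?bad = "{\<omega> \<in> space M. \<exists>x\<in>C. A \<omega> *v x = A \<omega> *v xbar\<^sub>0 \<and> f x < f xbar\<^sub>0}"
  \<comment> \<open>Homogeneity of C, f and the constraint allows \<open>x\<^sub>0\<close> to be
    rescaled to the unit vector \<open>xbar\<^sub>0\<close>.\<close>
  have "{\<omega> \<in> space M. \<not> is_arg_min f (\<lambda>x. x \<in> C \<and> A \<omega> *v x = A \<omega> *v x\<^sub>0) x\<^sub>0} = ?bad"
  proof (intro Collect_cong conj_cong refl)
    fix \<omega>
    let ?B = "A \<omega>" and ?r = "norm x\<^sub>0"
    have r: "0 < ?r" using \<open>x\<^sub>0 \<noteq> 0\<close> by simp
    have f_x\<^sub>0: "f x\<^sub>0 = ?r * f xbar\<^sub>0" using f_scale[of ?r xbar\<^sub>0] unfolding x\<^sub>0[symmetric] by simp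
    have B_x\<^sub>0: "?B *v x\<^sub>0 = ?r *\<^sub>R (?B *v xbar\<^sub>0)"
      using matrix_vector_mult_scaleR[of ?B ?r xbar\<^sub>0] unfolding x\<^sub>0[symmetric] .
    have "\<not> is_arg_min f (\<lambda>x. x \<in> C \<and> ?B *v x = ?B *v x\<^sub>0) x\<^sub>0 \<longleftrightarrow> (\<exists>x\<in>C. ?B *v x = ?B *v x\<^sub>0 \<and> f x < f x\<^sub>0)"
      using \<open>x\<^sub>0 \<in> C\<close> by (auto simp: is_arg_min_def)
    also have "\<dots> \<longleftrightarrow> (\<exists>x\<in>C. ?B *v x = ?B *v xbar\<^sub>0 \<and> f x < f xbar\<^sub>0)"
    proof safe
      fix x assume x: "x \<in> C" "?B *v x = ?B *v x\<^sub>0" "f x < f x\<^sub>0"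
      then have "x /\<^sub>R ?r \<in> C" "?B *v (x /\<^sub>R ?r) = ?B *v xbar\<^sub>0" "f (x /\<^sub>R ?r) < f xbar\<^sub>0"
        using \<open>cone C\<close> r by (auto simp: cone_def f_x\<^sub>0 B_x\<^sub>0 f_scale field_simps matrix_vector_mult_scaleR)
      then show "\<exists>x\<in>C. ?B *v x = ?B *v xbar\<^sub>0 \<and> f x < f xbar\<^sub>0" by blast
    next
      fix x assume x: "x \<in> C" "?B *v x = ?B *v xbar\<^sub>0" "f x < f xbar\<^sub>0"
      then have "?r *\<^sub>R x \<in> C" "?B *v (?r *\<^sub>R x) = ?B *v x\<^sub>0" "f (?r *\<^sub>R x) < f x\<^sub>0"
        using \<open>cone C\<close> r by (auto simp: cone_def f_x\<^sub>0 B_x\<^sub>0 f_scale matrix_vector_mult_scaleR)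
      then show "\<exists>x\<in>C. ?B *v x = ?B *v x\<^sub>0 \<and> f x < f x\<^sub>0" by blast
    qed
    finally show "\<not> is_arg_min f (\<lambda>x. x \<in> C \<and> ?B *v x = ?B *v x\<^sub>0) x\<^sub>0 \<longleftrightarrow> (\<exists>x\<in>C. ?B *v x = ?B *v xbar\<^sub>0 \<and> f x < f xbar\<^sub>0)" .
  qed
  moreover have "measure M ?bad \<ge> 1 - 3 * exp (- m_low / 16)"
    by (rule prob_feasible_decrease[OF \<open>prob_space M\<close> \<open>std_gaussian_matrix M A\<close> C xbar(1,2) f_add f_scale f_le f_cont f_pos \<Lambda> \<open>real CARD('m) \<le> m_low\<close> m_low R])
  \<comment> \<open>The minimum is at most \<open>m_low\<close>, so decay at rate
    \<open>m_low\<close> implies decay at the rate of the minimum.\<close>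
  moreover have "3 * exp (- m_low / 16) \<le> 10 * exp (- (1 / 16) * min m_low ((1 - ?D)\<^sup>2 * real CARD('n)))"
    by (intro mult_mono) auto
  ultimately show ?thesis by simp
qed

end
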